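(* Let $d = lev_{\gamma,\theta}$ (with $\gamma,\theta>0$) be an arbitrary generalized Levenshtein distance. Then for any integer $k\geq 2$ there exists a language $L$ over an alphabet of $k$ characters with growth $\Theta(k^{\sqrt{n}})$ such that $Isom_d(L)\cong S_k^\infty\times\prod_{n=1}^\infty S_{k^n}$.
   Context: For a finite alphabet $A$, $A^*$ is the set of all finite words over $A$ (including the empty word), and a language over $A$ is a subset of $A^*$; $|w|$ is the length of the word $w$. The growth of a language $L$ is the function $n\mapsto|\{w\in L : |w|\leq n\}|$. For real $\gamma,\theta>0$ the generalized Levenshtein distance with insertion (equivalently, removal) weight $\gamma$ and replacement weight $\theta$ is $$lev_{\gamma,\theta}(u,v)=\min\{\gamma n+\theta m \mid u \text{ can be transformed into } v \text{ by } n \text{ insertions or deletions of single characters and } m \text{ replacements of single characters}\}$$ where the intermediate words are arbitrary words of $A^*$. It is a metric on $A^*$. $Isom_d(L)$ is the group (under composition) of all bijections $\phi:L\to L$ with $d(\phi(u),\phi(v))=d(u,v)$ for all $u,v\in L$. $S_m$ is the symmetric group on $m$ elements, $\prod$ denotes the (unrestricted) Cartesian product of groups, and $S_k^\infty$ is the Cartesian product of countably infinitely many copies of $S_k$. *)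

theory Defs
  imports
    "HOL-Library.Landau_Symbols"
    "HOL-Algebra.Bij"
    "HOL-Algebra.Product_Groups"
    "HOL-Algebra.Sym_Groups"
begin

text \<open>\<^term>\<open>edits A n m u v\<close>: the word \<^term>\<open>u\<close> can be transformed into \<^term>\<open>v\<close>,
  staying within words over \<^term>\<open>A\<close>, by exactly \<^term>\<open>n\<close> insertions or deletions and
  \<^term>\<open>m\<close> replacements of single characters, in any order.\<close>

inductive edits :: "'a set \<Rightarrow> nat \<Rightarrow> nat \<Rightarrow> 'a list \<Rightarrow> 'a list \<Rightarrow> bool" for A where
  edits_refl: "u \<in> lists A \<Longrightarrow> edits A 0 0 u u"
| edits_insert: "edits A n m u (xs @ ys) \<Longrightarrow> a \<in> A \<Longrightarrow> edits A (Suc n) m u (xs @ a # ys)"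
| edits_delete: "edits A n m u (xs @ a # ys) \<Longrightarrow> edits A (Suc n) m u (xs @ ys)"
| edits_replace: "edits A n m u (xs @ a # ys) \<Longrightarrow> b \<in> A \<Longrightarrow> edits A n (Suc m) u (xs @ b # ys)"

text \<open>For positive weights and words over \<^term>\<open>A\<close> this minimum exists; see
  \<open>lev_attained\<close> and \<open>lev_le\<close> below.\<close>

definition lev :: "'a set \<Rightarrow> real \<Rightarrow> real \<Rightarrow> 'a list \<Rightarrow> 'a list \<Rightarrow> real" where
  "lev A \<gamma> \<theta> u v = (LEAST c. \<exists>n m. edits A n m u v \<and> c = \<gamma> * real n + \<theta> * real m)"

definition growth :: "'a list set \<Rightarrow> nat \<Rightarrow> nat" where
  "growth L n = card {w \<in> L. length w \<le> n}"

text \<open>As in \<^const>\<open>BijGroup\<close>, bijections of \<^term>\<open>L\<close> are represented by functions that are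
  \<^const>\<open>undefined\<close> outside \<^term>\<open>L\<close>.\<close>

definition isom_group :: "('w \<Rightarrow> 'w \<Rightarrow> real) \<Rightarrow> 'w set \<Rightarrow> ('w \<Rightarrow> 'w) monoid" where
  "isom_group d L =
    BijGroup L \<lparr>carrier := {\<phi> \<in> carrier (BijGroup L). \<forall>u\<in>L. \<forall>v\<in>L. d (\<phi> u) (\<phi> v) = d u v}\<rparr>"

lemma group_isom_group: "group (isom_group d L)"
proof -
  let ?H = "{\<phi> \<in> carrier (BijGroup L). \<forall>u\<in>L. \<forall>v\<in>L. d (\<phi> u) (\<phi> v) = d u v}"
  have mem: "f x \<in> L" if "f \<in> Bij L" "x \<in> L" for f x
    using that Bij_imp_funcset by blast
  have "subgroup ?H (BijGroup L)"
  proof (rule group.subgroupI[OF group_BijGroup])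
    show "?H \<subseteq> carrier (BijGroup L)" by blast
    have "(\<lambda>x\<in>L. x) \<in> ?H" by (auto simp: BijGroup_def id_Bij)
    then show "?H \<noteq> {}" by blast
  next
    fix f assume f: "f \<in> ?H"
    then have fB: "f \<in> Bij L" by (simp add: BijGroup_def)
    then have im: "f ` L = L" by (simp add: Bij_def bij_betw_def)
    have "d (inv_into L f u) (inv_into L f v) = d u v" if "u \<in> L" "v \<in> L" for u v
    proof -
      have "inv_into L f u \<in> L" "inv_into L f v \<in> L"
        using that fB by (auto intro: Bij_inv_into_mem)
      moreover have "f (inv_into L f u) = u" "f (inv_into L f v) = v"
        using that im by (auto intro: f_inv_into_f)
      ultimately show ?thesis using f by fastforce
    qed
    then show "inv\<^bsub>BijGroup L\<^esub> f \<in> ?H"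
      using fB restrict_inv_into_Bij[OF fB] by (simp add: inv_BijGroup) (simp add: BijGroup_def)
  next
    fix f g assume "f \<in> ?H" "g \<in> ?H"
    then show "f \<otimes>\<^bsub>BijGroup L\<^esub> g \<in> ?H"
      using compose_Bij[of f L g] by (simp add: BijGroup_def compose_eq mem)
  qed
  then show ?thesis
    unfolding isom_group_def by (rule subgroup.subgroup_is_group[OF _ group_BijGroup])
qed

lemma edits_exists:
  assumes "u \<in> lists A" "v \<in> lists A"
  shows "\<exists>n m. edits A n m u v"
proof -
  have del: "\<exists>n. edits A n 0 u (drop i u)" if "i \<le> length u" for i
    using that
  proof (induction i)
    case 0
    then show ?case using edits_refl[OF assms(1)] by auto
  next
    case (Suc i)
    then obtain n where "edits A n 0 u (drop i u)" by auto
    with Suc.prems show ?case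
      using edits_delete[of A n 0 u "[]" "u ! i" "drop (Suc i) u"]
      by (auto simp: Cons_nth_drop_Suc)
  qed
  from del[of "length u"] have nil: "\<exists>n. edits A n 0 u []" by auto
  have "\<exists>n. edits A n 0 u v"
    using assms(2)
  proof (induction v)
    case Nil
    show ?case by (rule nil)
  next
    case (Cons a v)
    then show ?case using edits_insert[of A _ 0 u "[]" v a] by fastforce
  qed
  then show ?thesis by blast
qed

lemma lev_min_exists:
  assumes "\<gamma> > 0" "\<theta> > 0" "u \<in> lists A" "v \<in> lists A"
  shows "\<exists>n m. edits A n m u v \<and>
    (\<forall>n' m'. edits A n' m' u v \<longrightarrow> \<gamma> * real n + \<theta> * real m \<le> \<gamma> * real n' + \<theta> * real m')"
proof -
  obtain n0 m0 where 0: "edits A n0 m0 u v" using edits_exists[OF assms(3,4)] by blast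
  define cost where "cost = (\<lambda>p. \<gamma> * real (fst p) + \<theta> * real (snd p))"
  define S where "S = {p. edits A (fst p) (snd p) u v \<and> cost p \<le> cost (n0, m0)}"
  have "S \<subseteq> {..nat \<lceil>cost (n0, m0) / \<gamma>\<rceil>} \<times> {..nat \<lceil>cost (n0, m0) / \<theta>\<rceil>}"
  proof
    fix p assume "p \<in> S"
    then have le: "cost p \<le> cost (n0, m0)" by (simp add: S_def)
    have "\<gamma> * real (fst p) \<le> cost (n0, m0)" "\<theta> * real (snd p) \<le> cost (n0, m0)"
    proof -
      have "0 \<le> \<gamma> * real (fst p)" "0 \<le> \<theta> * real (snd p)"
        using assms(1,2) by simp_all
      with le show "\<gamma> * real (fst p) \<le> cost (n0, m0)" "\<theta> * real (snd p) \<le> cost (n0, m0)"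
        unfolding cost_def by linarith+
    qed
    then have "real (fst p) \<le> cost (n0, m0) / \<gamma>" "real (snd p) \<le> cost (n0, m0) / \<theta>"
      using assms(1,2) by (simp_all add: field_simps)
    then have "fst p \<le> nat \<lceil>cost (n0, m0) / \<gamma>\<rceil>" "snd p \<le> nat \<lceil>cost (n0, m0) / \<theta>\<rceil>"
      by linarith+
    then show "p \<in> {..nat \<lceil>cost (n0, m0) / \<gamma>\<rceil>} \<times> {..nat \<lceil>cost (n0, m0) / \<theta>\<rceil>}"
      by (simp add: mem_Times_iff)
  qed
  then have fin: "finite S" by (rule finite_subset) simp
  have "(n0, m0) \<in> S" using 0 by (simp add: S_def)
  then have "S \<noteq> {}" by blast
  define p where "p = arg_min_on cost S"
  have p: "p \<in> S" "\<And>q. q \<in> S \<Longrightarrow> cost p \<le> cost q"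
    unfolding p_def
    by (rule arg_min_if_finite(1)[OF fin \<open>S \<noteq> {}\<close>], rule arg_min_least[OF fin \<open>S \<noteq> {}\<close>])
  have "cost p \<le> cost q" if "edits A (fst q) (snd q) u v" for q
  proof (cases "cost q \<le> cost (n0, m0)")
    case True
    with that show ?thesis by (intro p(2)) (simp add: S_def)
  next
    case False
    with p(2)[OF \<open>(n0, m0) \<in> S\<close>] show ?thesis by linarith
  qed
  then have "\<gamma> * real (fst p) + \<theta> * real (snd p) \<le> \<gamma> * real n' + \<theta> * real m'"
    if "edits A n' m' u v" for n' m'
    using that by (fastforce simp: cost_def)
  moreover have "edits A (fst p) (snd p) u v" using p(1) by (simp add: S_def)
  ultimately show ?thesis by blast
qed

lemma
  assumes "\<gamma> > 0" "\<theta> > 0" "u \<in> lists A" "v \<in> lists A"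
  shows lev_attained: "\<exists>n m. edits A n m u v \<and> lev A \<gamma> \<theta> u v = \<gamma> * real n + \<theta> * real m"
    and lev_le: "edits A n' m' u v \<Longrightarrow> lev A \<gamma> \<theta> u v \<le> \<gamma> * real n' + \<theta> * real m'"
proof -
  obtain n m where nm: "edits A n m u v"
    "\<And>n' m'. edits A n' m' u v \<Longrightarrow> \<gamma> * real n + \<theta> * real m \<le> \<gamma> * real n' + \<theta> * real m'"
    using lev_min_exists[OF assms] by blast
  have "lev A \<gamma> \<theta> u v = \<gamma> * real n + \<theta> * real m"
    unfolding lev_def by (rule Least_equality) (use nm in auto)
  then show "\<exists>n m. edits A n m u v \<and> lev A \<gamma> \<theta> u v = \<gamma> * real n + \<theta> * real m"
    and "edits A n' m' u v \<Longrightarrow> lev A \<gamma> \<theta> u v \<le> \<gamma> * real n' + \<theta> * real m'"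
    using nm by auto
qed

end

theory Submission
  imports Defs "HOL-Library.Sublist"
begin

text \<open>The language consists of the empty word, fillers, clusters and references. Let \<open>a\<close> and \<open>b\<close> be
  distinct letters. A cluster is a set of words \<open>a ... a b a ... a\<close> of equal length which differ only
  in the position of \<open>b\<close>. Its words are equidistant, and they have the same distance to every other
  word of the language: longer words contain all of them as subsequences, and for a shorter word ending
  in \<open>b\<close> the distance depends only on its length and on its number of letters different from \<open>a\<close>. So
  all permutations of the clusters are isometries, whose group is the product of symmetric groups
  once the clusters have the required sizes; they can be placed at very sparse lengths.

  The fillers, about \<open>k ^ (4 * m)\<close> words of length about \<open>(4 * m) ^ 2\<close> for every \<open>m\<close>, give the growth.
  They are made rigid by the references, which have sparse and pairwise distinct lengths: a reference
  contains all fillers of some length except one, and \<open>lev\<close> equals \<open>\<gamma>\<close> times the difference of the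
  lengths exactly if the shorter word is a subsequence of the longer one. Finally, the empty word is the
  only isolated point and hence fixed by every isometry; so isometries preserve lengths.\<close>

section \<open>Generalized Levenshtein distance\<close>

lemma edits_in_lists: "edits A n m u v \<Longrightarrow> u \<in> lists A \<and> v \<in> lists A"
  by (induction rule: edits.induct) auto

text \<open>A derivation of \<open>edits\<close> grows only at its target, so the induction runs
  over the second leg, which is therefore the first premise.\<close>

lemma edits_trans:
  assumes "edits A n' m' v w" "edits A n m u v"
  shows "edits A (n + n') (m + m') u w"
  using assms by (induction rule: edits.induct) (auto intro: edits.intros)

text \<open>The last step is undone by a one-step derivation of the same cost, and the reversed
  remainder is appended to it by \<open>edits_trans\<close>.\<close>

lemma edits_sym: "edits A n m u v \<Longrightarrow> edits A n m v u"
proof (induction rule: edits.induct)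
  case (edits_refl u)
  then show ?case by (rule edits.edits_refl)
next
  case (edits_insert n m u xs ys a)
  then have "edits A 0 0 (xs @ a # ys) (xs @ a # ys)"
    by (intro edits.edits_refl) (auto dest: edits_in_lists)
  then have "edits A (Suc 0) 0 (xs @ a # ys) (xs @ ys)" by (rule edits.edits_delete)
  from edits_trans[OF edits_insert.IH this] show ?case by simp
next
  case (edits_delete n m u xs a ys)
  then have "a \<in> A" "edits A 0 0 (xs @ ys) (xs @ ys)"
    by (auto intro!: edits.edits_refl dest: edits_in_lists)
  then have "edits A (Suc 0) 0 (xs @ ys) (xs @ a # ys)" by (intro edits.edits_insert)
  from edits_trans[OF edits_delete.IH this] show ?case by simp
next
  case (edits_replace n m u xs a ys b)
  then have "a \<in> A" "edits A 0 0 (xs @ b # ys) (xs @ b # ys)"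
    using edits_in_lists[OF edits_replace.hyps(1)] by (auto intro!: edits.edits_refl)
  then have "edits A 0 (Suc 0) (xs @ b # ys) (xs @ a # ys)" by (metis edits.edits_replace)
  from edits_trans[OF edits_replace.IH this] show ?case by simp
qed

lemma edits_context:
  assumes "edits A n m u v" "p \<in> lists A" "q \<in> lists A"
  shows "edits A n m (p @ u @ q) (p @ v @ q)"
  using assms
proof (induction rule: edits.induct)
  case (edits_refl u)
  then show ?case by (intro edits.edits_refl) auto
next
  case (edits_insert n m u xs ys a)
  then show ?case using edits.edits_insert[of A n m "p @ u @ q" "p @ xs" "ys @ q" a] by simp
next
  case (edits_delete n m u xs a ys)
  then show ?case using edits.edits_delete[of A n m "p @ u @ q" "p @ xs" a "ys @ q"] by simp
next
  case (edits_replace n m u xs a ys b)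
  then show ?case using edits.edits_replace[of A n m "p @ u @ q" "p @ xs" a "ys @ q" b] by simp
qed

lemma edits_subseq:
  assumes "subseq u v" "v \<in> lists A"
  shows "edits A (length v - length u) 0 u v"
  using assms
proof (induction rule: list_emb.induct)
  case (list_emb_Nil ys)
  then show ?case
  proof (induction ys)
    case (Cons y ys)
    then show ?case using edits_insert[of A "length ys" 0 "[]" "[]" ys y] by simp
  qed (simp add: edits_refl)
next
  case (list_emb_Cons xs ys y)
  then have "length xs \<le> length ys" by (simp add: list_emb_length)
  then show ?case
    using list_emb_Cons edits_insert[of A "length ys - length xs" 0 xs "[]" ys y]
    by (simp add: Suc_diff_le)
next
  case (list_emb_Cons2 x y xs ys)
  then show ?case using edits_context[of A _ _ xs ys "[x]" "[]"] by simp
qed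

lemma edits_length_le:
  assumes "edits A n m u v"
  shows "length v \<le> length u + n"
  using assms by (induction rule: edits.induct) auto

text \<open>Converse of \<open>edits_subseq\<close>. A deletion anywhere would keep the target
  shorter than \<open>length u + n\<close> by \<open>edits_length_le\<close>, so all steps are
  insertions.\<close>

lemma subseq_of_edits:
  assumes "edits A n m u v" "m = 0" "length v = length u + n"
  shows "subseq u v"
  using assms
proof (induction rule: edits.induct)
  case (edits_insert n m u xs ys a)
  then have "subseq u (xs @ ys)" by simp
  moreover have "subseq (xs @ ys) (xs @ a # ys)" by (intro list_emb_append_mono) auto
  ultimately show ?case by (rule subseq_order.trans)
next
  case (edits_delete n m u xs a ys)
  then show ?case using edits_length_le[OF edits_delete.hyps] by simp
qed auto

text \<open>Here \<open>p\<close> counts insertions and \<open>q\<close> deletions. An insertion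
  never lowers the number of letters satisfying \<open>P\<close>; a deletion or a replacement lowers
  it by at most one.\<close>

lemma edits_count:
  assumes "edits A n m u v"
  obtains p q where "n = p + q" "length v + q = length u + p"
    "length (filter P u) \<le> length (filter P v) + q + m"
proof -
  have "\<exists>p q. n = p + q \<and> length v + q = length u + p \<and>
    length (filter P u) \<le> length (filter P v) + q + m"
    using assms
  proof (induction rule: edits.induct)
    case (edits_insert n m u xs ys a)
    then obtain p q where "n = p + q" "length (xs @ ys) + q = length u + p"
      "length (filter P u) \<le> length (filter P (xs @ ys)) + q + m" by blast
    then show ?case by (intro exI[of _ "Suc p"] exI[of _ q]) auto
  next
    case (edits_delete n m u xs a ys)
    then obtain p q where "n = p + q" "length (xs @ a # ys) + q = length u + p"
      "length (filter P u) \<le> length (filter P (xs @ a # ys)) + q + m" by blast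
    then show ?case by (intro exI[of _ p] exI[of _ "Suc q"]) (auto split: if_splits)
  next
    case (edits_replace n m u xs a ys b)
    then obtain p q where "n = p + q" "length (xs @ a # ys) + q = length u + p"
      "length (filter P u) \<le> length (filter P (xs @ a # ys)) + q + m" by blast
    then show ?case by (intro exI[of _ p] exI[of _ q]) (auto split: if_splits)
  qed auto
  then show ?thesis using that by blast
qed

text \<open>Without insertions and deletions the positions stay aligned, and each replacement
  affects a single position.\<close>

lemma edits_0_hamming:
  assumes "edits A n m u v" "n = 0"
  shows "length u = length v \<and> card {i. i < length v \<and> u ! i \<noteq> v ! i} \<le> m"
  using assms
proof (induction rule: edits.induct)
  case (edits_replace n m u xs a ys b)
  let ?v = "xs @ a # ys" and ?w = "xs @ b # ys"
  have "{i. i < length ?w \<and> u ! i \<noteq> ?w ! i} \<subseteq> insert (length xs) {i. i < length ?v \<and> u ! i \<noteq> ?v ! i}"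
    by (auto simp: nth_append nth_Cons')
  then have "card {i. i < length ?w \<and> u ! i \<noteq> ?w ! i} \<le> Suc (card {i. i < length ?v \<and> u ! i \<noteq> ?v ! i})"
    by (rule le_trans[OF card_mono, rotated]) (auto simp: card_insert_if)
  with edits_replace show ?case by simp
qed auto

section \<open>Exact values of the weighted distance\<close>

locale weighted_lev =
  fixes A :: "'a set" and \<gamma> \<theta> :: real
  assumes pos: "\<gamma> > 0" "\<theta> > 0"
begin

abbreviation d :: "'a list \<Rightarrow> 'a list \<Rightarrow> real" where "d \<equiv> lev A \<gamma> \<theta>"

lemma lev_sym: "d u v = d v u"
proof -
  have "edits A n m u v = edits A n m v u" for n m using edits_sym by blast
  then show ?thesis by (simp add: lev_def)
qed

lemma levE:
  assumes "u \<in> lists A" "v \<in> lists A"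
  obtains n m where "edits A n m u v" "d u v = \<gamma> * real n + \<theta> * real m"
  using lev_attained[OF pos assms] by blast

lemma lev_leI:
  assumes "edits A n m u v"
  shows "d u v \<le> \<gamma> * real n + \<theta> * real m"
  using lev_le[OF pos _ _ assms] edits_in_lists[OF assms] by blast

lemma lev_ge_length:
  assumes "u \<in> lists A" "v \<in> lists A"
  shows "\<gamma> * (real (length v) - real (length u)) \<le> d u v"
proof -
  obtain n m where nm: "edits A n m u v" "d u v = \<gamma> * real n + \<theta> * real m"
    using levE[OF assms] .
  have "real (length v) - real (length u) \<le> real n"
    using edits_length_le[OF nm(1)] by linarith
  then have "\<gamma> * (real (length v) - real (length u)) \<le> \<gamma> * real n" using pos by simp
  also have "\<dots> \<le> \<gamma> * real n + \<theta> * real m" using pos by simp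
  finally show ?thesis using nm by simp
qed

lemma lev_subseq:
  assumes "subseq u v" "v \<in> lists A"
  shows "d u v = \<gamma> * (real (length v) - real (length u))"
proof -
  have "u \<in> lists A" using edits_in_lists[OF edits_subseq[OF assms]] by simp
  moreover have "length u \<le> length v" using assms by (simp add: list_emb_length)
  ultimately show ?thesis
    using lev_leI[OF edits_subseq[OF assms]] lev_ge_length[OF _ assms(2), of u]
    by (simp add: of_nat_diff)
qed

lemma lev_not_subseq:
  assumes "\<not> subseq u v" "u \<in> lists A" "v \<in> lists A"
  shows "d u v > \<gamma> * (real (length v) - real (length u))"
proof -
  obtain n m where nm: "edits A n m u v" "d u v = \<gamma> * real n + \<theta> * real m"
    using levE[OF assms(2,3)] .
  have le: "real (length v) - real (length u) \<le> real n"
    using edits_length_le[OF nm(1)] by linarith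
  consider "m > 0" | "real (length v) - real (length u) < real n"
    using subseq_of_edits[OF nm(1)] assms(1) le by fastforce
  then show ?thesis
  proof cases
    case 1
    then have "\<theta> * real m > 0" using pos by simp
    moreover have "\<gamma> * (real (length v) - real (length u)) \<le> \<gamma> * real n" using pos le by simp
    ultimately show ?thesis using nm by linarith
  next
    case 2
    then have "\<gamma> * (real (length v) - real (length u)) < \<gamma> * real n" using pos by simp
    moreover have "\<theta> * real m \<ge> 0" using pos by simp
    ultimately show ?thesis using nm by linarith
  qed
qed

lemma lev_Nil: "v \<in> lists A \<Longrightarrow> d [] v = \<gamma> * real (length v)"
  using lev_subseq[of "[]" v] by simp

text \<open>A letter becomes \<open>a\<close> by a replacement, of cost \<theta>, or by a deletion
  and an insertion, of cost \<open>2 * \<gamma>\<close>; the cheaper way is taken for each letter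
  other than \<open>a\<close>.\<close>

lemma edits_blank:
  assumes "u \<in> lists A" "a \<in> A"
  shows "\<exists>n m. edits A n m u (replicate (length u) a) \<and>
    \<gamma> * real n + \<theta> * real m = min (2 * \<gamma>) \<theta> * real (length (filter (\<lambda>x. x \<noteq> a) u))"
  using assms(1)
proof (induction u)
  case Nil
  have "edits A 0 0 [] []" by (simp add: edits_refl)
  then show ?case by fastforce
next
  case (Cons x u)
  let ?r = "replicate (length u) a"
  from Cons obtain n m where "edits A n m u ?r" and
    c: "\<gamma> * real n + \<theta> * real m = min (2 * \<gamma>) \<theta> * real (length (filter (\<lambda>x. x \<noteq> a) u))" by auto
  have e: "edits A n m (x # u) (x # ?r)"
    using edits_context[OF \<open>edits A n m u ?r\<close>, of "[x]" "[]"] Cons.hyps by simp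
  consider "x = a" | "x \<noteq> a" "\<theta> \<le> 2 * \<gamma>" | "x \<noteq> a" "2 * \<gamma> \<le> \<theta>" by linarith
  then show ?case
  proof cases
    case 1
    with e c show ?thesis by auto
  next
    case 2
    have "edits A n (Suc m) (x # u) (a # ?r)"
      using edits_replace[of A n m "x # u" "[]" x ?r a] e assms by simp
    with c 2 show ?thesis
      by (intro exI[of _ n] exI[of _ "Suc m"]) (simp add: algebra_simps)
  next
    case 3
    have "edits A (Suc n) m (x # u) ?r"
      using edits_delete[of A n m "x # u" "[]" x ?r] e by simp
    then have "edits A (Suc (Suc n)) m (x # u) (a # ?r)"
      using edits_insert[of A "Suc n" m "x # u" "[]" ?r a] assms by simp
    with c 3 show ?thesis
      by (intro exI[of _ "Suc (Suc n)"] exI[of _ m]) (simp add: algebra_simps)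
  qed
qed

text \<open>For the lower bound: if \<open>q\<close> letters are deleted, then \<open>2 * q\<close> indels do not contribute to the
  difference of the lengths, and only deletions and replacements remove letters other than \<open>a\<close>.\<close>

lemma lev_one_mark:
  assumes "u \<in> lists A" "a \<in> A" "b \<in> A" "a \<noteq> b" "length u \<le> s"
  shows "d (u @ [b]) (replicate s a @ b # replicate i a) =
    \<gamma> * (real s + real i - real (length u)) +
    min (2 * \<gamma>) \<theta> * real (length (filter (\<lambda>x. x \<noteq> a) u))"
    (is "d ?x ?c = ?R")
proof (rule antisym)
  \<comment> \<open>Upper bound: turn the letters of \<open>u\<close> into \<open>a\<close>, then
    only insert letters \<open>a\<close>.\<close>
  obtain n m where nm: "edits A n m u (replicate (length u) a)"
    "\<gamma> * real n + \<theta> * real m = min (2 * \<gamma>) \<theta> * real (length (filter (\<lambda>x. x \<noteq> a) u))"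
    using edits_blank[OF assms(1,2)] by blast
  from edits_context[OF nm(1), of "[]" "[b]"] assms
  have 1: "edits A n m ?x (replicate (length u) a @ [b])" by simp
  have "subseq (replicate (length u) a) (replicate s a)"
    using assms(5) by (metis le_add_diff_inverse replicate_add prefix_imp_subseq prefixI)
  then have "subseq (replicate (length u) a @ [b]) ?c"
    by (intro list_emb_append_mono) auto
  moreover have "?c \<in> lists A" using assms by (auto simp: in_lists_conv_set)
  ultimately have "edits A (length ?c - length (replicate (length u) a @ [b])) 0
    (replicate (length u) a @ [b]) ?c" by (rule edits_subseq)
  from lev_leI[OF edits_trans[OF this 1]] nm(2) assms(5)
  show "d ?x ?c \<le> ?R" by (simp add: of_nat_diff algebra_simps)
next
  have "?x \<in> lists A" "?c \<in> lists A" using assms by (auto simp: in_lists_conv_set)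
  then obtain n m where nm: "edits A n m ?x ?c" "d ?x ?c = \<gamma> * real n + \<theta> * real m"
    using levE by blast
  obtain p q where pq: "n = p + q" "length ?c + q = length ?x + p"
    "length (filter (\<lambda>x. x \<noteq> a) ?x) \<le> length (filter (\<lambda>x. x \<noteq> a) ?c) + q + m"
    using edits_count[OF nm(1)] .
  then have Z: "real (length (filter (\<lambda>x. x \<noteq> a) u)) \<le> real q + real m"
    using assms(4) by simp
  have p: "real p = real s + real i - real (length u) + real q" using pq(2) by simp
  have "min (2 * \<gamma>) \<theta> * real (length (filter (\<lambda>x. x \<noteq> a) u)) \<le> min (2 * \<gamma>) \<theta> * (real q + real m)"
    using Z pos by (intro mult_left_mono) auto
  also have "\<dots> \<le> 2 * \<gamma> * real q + \<theta> * real m"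
    by (simp add: distrib_left add_mono mult_right_mono)
  finally show "?R \<le> d ?x ?c"
    using nm(2) pq(1) p by (simp add: algebra_simps)
qed

text \<open>The mark moves by one deletion and one insertion, or by two replacements. Conversely,
  equal lengths force as many insertions as deletions, so \<open>n\<close> is 0 or at least 2; for
  \<open>n = 0\<close> the words differ at both positions of the mark.\<close>

lemma lev_shift_mark:
  assumes "a \<in> A" "b \<in> A" "a \<noteq> b" "s + i = s' + i'" "i \<noteq> i'"
  shows "d (replicate s a @ b # replicate i a) (replicate s' a @ b # replicate i' a) = min (2 * \<gamma>) (2 * \<theta>)"
    (is "d ?x ?y = _")
proof (rule antisym)
  have xy: "?x \<in> lists A" "?y \<in> lists A" using assms by (auto simp: in_lists_conv_set)
  have x0: "edits A 0 0 ?x ?x" using xy by (simp add: edits_refl)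
  have "edits A 1 0 ?x (replicate s a @ replicate i a)"
    using edits_delete[OF x0] by simp
  moreover have "replicate s a @ replicate i a = replicate s' a @ replicate i' a"
    using assms(4) by (simp flip: replicate_add)
  ultimately have "edits A 1 0 ?x (replicate s' a @ replicate i' a)" by simp
  from edits_insert[OF this assms(2)] have e: "edits A (Suc 1) 0 ?x ?y" .
  have "edits A 0 1 ?x (replicate s a @ a # replicate i a)"
    using edits_replace[OF x0 assms(1)] by simp
  moreover have "replicate s a @ a # replicate i a = replicate s' a @ a # replicate i' a"
    using assms(4) by (metis replicate_Suc replicate_add add_Suc_right)
  ultimately have "edits A 0 1 ?x (replicate s' a @ a # replicate i' a)" by simp
  from edits_replace[OF this assms(2)] have "edits A 0 (Suc 1) ?x ?y" .
  from lev_leI[OF this] lev_leI[OF e] show "d ?x ?y \<le> min (2 * \<gamma>) (2 * \<theta>)" by simp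
  obtain n m where nm: "edits A n m ?x ?y" "d ?x ?y = \<gamma> * real n + \<theta> * real m"
    using levE[OF xy] .
  obtain p q where pq: "n = p + q" "length ?y + q = length ?x + p"
    using edits_count[OF nm(1)] by metis
  show "min (2 * \<gamma>) (2 * \<theta>) \<le> d ?x ?y"
  proof (cases "n = 0")
    case True
    have "{s, s'} \<subseteq> {j. j < length ?y \<and> ?x ! j \<noteq> ?y ! j}"
      using assms by (auto simp: nth_append nth_Cons')
    from card_mono[OF _ this] have "2 \<le> card {j. j < length ?y \<and> ?x ! j \<noteq> ?y ! j}"
      using assms by (simp split: if_splits)
    with edits_0_hamming[OF nm(1) True] have "2 \<le> m" by linarith
    then have "\<theta> * 2 \<le> \<theta> * real m" using pos by simp
    then show ?thesis using nm(2) True by simp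
  next
    case False
    then have "2 \<le> n" using pq assms(4) by simp
    then have "\<gamma> * 2 \<le> \<gamma> * real n" using pos by simp
    moreover have "0 \<le> \<theta> * real m" using pos by simp
    ultimately show ?thesis using nm(2) by linarith
  qed
qed

end

section \<open>Supersequences of all words of a given length except one\<close>

lemma subseq_Cons_skip: "c \<notin> set e \<Longrightarrow> subseq (c # x) (e @ y) \<longleftrightarrow> subseq (c # x) y"
  by (induction e) (auto simp: subseq_Cons2_neq)

text \<open>Writing \<open>c # x\<close> for the word to avoid, prepend to a solution for \<open>x\<close> a word containing all short
  words without \<open>c\<close>, followed by \<open>c\<close>. A word starting with another letter then has more room than
  it needs.\<close>

lemma avoiding_supersequence:
  assumes "x \<noteq> []" "x \<in> lists A" "finite A" "card A \<ge> 2"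
  shows "\<exists>r\<in>lists A. \<not> subseq x r \<and> (\<forall>y\<in>lists A. length y = length x \<longrightarrow> y \<noteq> x \<longrightarrow> subseq y r)"
  using assms(1,2)
proof (induction x)
  case (Cons c x)
  obtain e where e: "set e = A - {c}" using finite_list[of "A - {c}"] assms(3) by auto
  show ?case
  proof (cases "x = []")
    case True
    have "\<forall>y\<in>lists A. length y = Suc 0 \<longrightarrow> y \<noteq> [c] \<longrightarrow> subseq y e"
      using e by (auto simp: length_Suc_conv subseq_singleton_left)
    moreover have "\<not> subseq [c] e" using e by (simp add: subseq_singleton_left)
    ultimately show ?thesis using True e by (intro bexI[of _ e]) auto
  next
    case False
    then obtain r where r: "r \<in> lists A" "\<not> subseq x r"
      "\<And>y. y \<in> lists A \<Longrightarrow> length y = length x \<Longrightarrow> y \<noteq> x \<Longrightarrow> subseq y r"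
      using Cons.IH[OF False] Cons.prems by (metis Cons_in_lists_iff)
    \<comment> \<open>Each letter of \<open>z\<close> is found in a copy of \<open>e\<close> of its
      own.\<close>
    have e_pow: "subseq z (concat (replicate n e))" if "z \<in> lists (A - {c})" "length z \<le> n" for z n
      using that
    proof (induction z arbitrary: n)
      case (Cons z zs)
      then obtain n' where n': "n = Suc n'" by (cases n) auto
      have "subseq [z] e" using Cons.hyps e by (simp add: subseq_singleton_left)
      with Cons.IH[of n'] Cons.prems n' show ?case
        using list_emb_append_mono[of "(=)" "[z]" e zs] by simp
    qed simp
    \<comment> \<open>Padding \<open>z\<close> on the left with a letter other than
      \<open>hd x\<close> yields a word of the length of \<open>x\<close> that differs from
      \<open>x\<close>, so the hypothesis on \<open>r\<close> applies.\<close>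
    have short: "subseq z r" if z: "z \<in> lists A" "length z < length x" for z
    proof -
      have "\<not> A \<subseteq> {hd x}" using assms(4) card_mono[of "{hd x}" A] by auto
      then obtain c' where c': "c' \<in> A" "c' \<noteq> hd x" by blast
      let ?y = "replicate (length x - length z) c' @ z"
      obtain l where "length x - length z = Suc l" using z by (metis Suc_diff_Suc)
      then have "hd ?y = c'" by simp
      then have "?y \<noteq> x" using c' by metis
      then have "subseq ?y r" using z c' by (intro r(3)) (auto simp: in_lists_conv_set)
      moreover have "subseq z ?y" by (rule list_emb_append2) simp
      ultimately show ?thesis using subseq_order.trans by blast
    qed
    define E where "E = concat (replicate (length (c # x)) e)"
    have E: "set E \<subseteq> A - {c}" using e by (auto simp: E_def)
    \<comment> \<open>As \<open>E\<close> is free of \<open>c\<close>, the first letter is matched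
      after \<open>E\<close> at the earliest, which leaves \<open>x\<close> to be embedded into
      \<open>r\<close>.\<close>
    have "\<not> subseq (c # x) (E @ c # r)"
      using E r(2) subseq_Cons_skip[of c E x "c # r"] by auto
    moreover have "subseq y (E @ c # r)"
      if y: "y \<in> lists A" "length y = length (c # x)" "y \<noteq> c # x" for y
    proof -
      obtain z zs where z: "y = z # zs" "length zs = length x" using y(2) by (cases y) auto
      show ?thesis
      proof (cases "z = c")
        case True
        with y z have "subseq zs r" by (intro r(3)) auto
        with True z have "subseq y (c # r)" by simp
        then show ?thesis by (rule list_emb_append2)
      next
        case False
        \<comment> \<open>Cut \<open>y\<close> before its first \<open>c\<close>. The part
          \<open>p\<close> fits into \<open>E\<close>; the rest is empty or a \<open>c\<close>
          followed by a word shorter than \<open>x\<close>, because \<open>p\<close> is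
          nonempty.\<close>
        define p q where "p = takeWhile (\<lambda>l. l \<noteq> c) y" and "q = dropWhile (\<lambda>l. l \<noteq> c) y"
        have pq: "y = p @ q" by (simp add: p_def q_def)
        have "p \<in> lists (A - {c})" "length p \<le> length (c # x)"
          using y by (auto simp: p_def dest: set_takeWhileD length_takeWhile_le[THEN le_trans])
            (metis length_takeWhile_le y(2) list.size(4) add_Suc_right add_0_right One_nat_def)
        then have "subseq p E" unfolding E_def by (rule e_pow)
        moreover have "subseq q (c # r)"
        proof (cases q)
          case (Cons h q')
          then have h: "h = c" unfolding q_def by (metis (mono_tags) dropWhile_eq_Cons_conv)
          have "length p > 0" using False z by (simp add: p_def)
          moreover have "length p + length q' = length x" using pq y(2) Cons by simp
          ultimately have "length q' < length x" by linarith
          moreover have "q' \<in> lists A" using pq y(1) Cons by simp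
          ultimately show ?thesis using short[of q'] Cons h by simp
        qed simp
        ultimately show ?thesis unfolding pq by (rule list_emb_append_mono)
      qed
    qed
    moreover have "E @ c # r \<in> lists A" using E r(1) Cons.prems by auto
    ultimately show ?thesis by blast
  qed
qed simp

section \<open>Products of symmetric groups\<close>

lemma product_group_cong:
  "(\<And>i. i \<in> I \<Longrightarrow> G i = H i) \<Longrightarrow> product_group I G = product_group I H"
  by (simp add: product_group_def cong: PiE_cong restrict_cong)

text \<open>De-interleaving a sequence. Odd positions are written \<open>2 * n - 1\<close> so that
  the second factor is indexed from 1; then \<open>n\<close> is recovered as
  \<open>Suc j div 2\<close>.\<close>

lemma product_group_even_odd:
  "product_group (UNIV :: nat set) G \<cong>
    product_group (UNIV :: nat set) (\<lambda>i. G (2 * i)) \<times>\<times> product_group {n :: nat. n \<ge> 1} (\<lambda>n. G (2 * n - 1))"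
    (is "?P \<cong> ?Q")
proof (rule is_isoI, rule isoI)
  let ?h = "\<lambda>f. (\<lambda>i. f (2 * i), \<lambda>n\<in>{n :: nat. n \<ge> 1}. f (2 * n - 1))"
  let ?g = "\<lambda>(p, q) j. if even j then p (j div 2) else q (Suc j div 2)"
  show "?h \<in> hom ?P ?Q"
    by (rule homI) (auto simp: PiE_iff)
  show "bij_betw ?h (carrier ?P) (carrier ?Q)"
  proof (rule bij_betw_byWitness[where f' = ?g])
    show "\<forall>f\<in>carrier ?P. ?g (?h f) = f" by (auto simp: fun_eq_iff elim!: oddE)
    show "\<forall>r\<in>carrier ?Q. ?h (?g r) = r"
      by (auto simp: fun_eq_iff PiE_iff restrict_def extensional_def)
    show "?h ` carrier ?P \<subseteq> carrier ?Q" by (auto simp: PiE_iff extensional_def split: if_splits)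
    show "?g ` carrier ?Q \<subseteq> carrier ?P"
    proof
      fix f assume "f \<in> ?g ` carrier ?Q"
      then obtain p q where f: "f = ?g (p, q)" "\<And>i. p i \<in> carrier (G (2 * i))"
        "\<And>n. n \<ge> 1 \<Longrightarrow> q n \<in> carrier (G (2 * n - 1))" by (auto simp: PiE_iff)
      have "f j \<in> carrier (G j)" for j
        using f(2)[of "j div 2"] f(3)[of "Suc j div 2"] f(1) by (cases "even j") (auto elim!: oddE)
      then show "f \<in> carrier ?P" by (simp add: PiE_iff)
    qed
  qed
qed

text \<open>By \<open>char\<close>, an isometry acts on the disjoint finite blocks
  \<open>C j\<close> independently and arbitrarily. Numbering each block turns its action into one
  permutation of \<open>{1..N j}\<close> per block.\<close>

lemma isom_group_iso_product_sym_group: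
  assumes fin: "\<And>j. finite (C j)" and card: "\<And>j. card (C j) = N j" and sub: "\<And>j :: nat. C j \<subseteq> L"
    and disj: "\<And>i j. i \<noteq> j \<Longrightarrow> C i \<inter> C j = {}"
    and char: "\<And>\<phi>. \<phi> \<in> Bij L \<Longrightarrow> (\<forall>u\<in>L. \<forall>v\<in>L. d (\<phi> u) (\<phi> v) = d u v) \<longleftrightarrow>
      (\<forall>x\<in>L - (\<Union>j. C j). \<phi> x = x) \<and> (\<forall>j. \<phi> ` C j = C j)"
  shows "isom_group d L \<cong> product_group (UNIV :: nat set) (\<lambda>j. sym_group (N j))"
proof -
  let ?P = "product_group (UNIV :: nat set) (\<lambda>j. sym_group (N j))" and ?I = "isom_group d L"
  have "\<forall>j. \<exists>f. bij_betw f {1..N j} (C j)"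
    using ex_bij_betw_nat_finite_1[OF fin] by (simp add: card)
  then obtain f where f: "\<And>j. bij_betw (f j) {1..N j} (C j)" by metis
  define g where "g j = inv_into {1..N j} (f j)" for j
  have g: "bij_betw (g j) (C j) {1..N j}" for j unfolding g_def by (rule bij_betw_inv_into[OF f])
  have gf[simp]: "g j (f j i) = i" if "i \<in> {1..N j}" for i j
    unfolding g_def using f that by (metis bij_betw_inv_into_left)
  have fg[simp]: "f j (g j x) = x" if "x \<in> C j" for x j
    unfolding g_def using f that by (metis bij_betw_inv_into_right)
  have fC: "f j i \<in> C j" if "i \<in> {1..N j}" for i j using f that bij_betwE by blast
  have gC: "g j x \<in> {1..N j}" if "x \<in> C j" for x j using g that bij_betwE by blast
  define idx where "idx x = (THE j. x \<in> C j)" for x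
  have idx: "idx x = j" if "x \<in> C j" for x j
    unfolding idx_def using that disj by (blast intro: the_equality)
  \<comment> \<open>Each block is permuted through its numbering; \<open>idx\<close> finds the block
    of a point. The restriction to \<open>L\<close> matches the convention of
    \<open>Bij\<close>.\<close>
  define \<Psi> where "\<Psi> p = (\<lambda>x\<in>L. if x \<in> (\<Union>j. C j) then f (idx x) (p (idx x) (g (idx x) x)) else x)" for p
  have \<Psi>_C: "\<Psi> p x = f j (p j (g j x))" if "x \<in> C j" for p x j
    using that sub idx by (auto simp: \<Psi>_def)
  have \<Psi>_out: "\<Psi> p x = x" if "x \<in> L - (\<Union>j. C j)" for p x
    using that by (auto simp: \<Psi>_def)
  have carrier_P: "p \<in> carrier ?P \<longleftrightarrow> (\<forall>j. p j permutes {1..N j})" for p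
    by (simp add: PiE_iff sym_group_def)
  have \<Psi>_mem: "\<Psi> p x \<in> C j" if "x \<in> C j" "p \<in> carrier ?P" for p x j
  proof -
    have "p j permutes {1..N j}" using that(2) unfolding carrier_P by blast
    then have "p j (g j x) \<in> {1..N j}" using gC[OF that(1)] by (simp only: permutes_in_image)
    then show ?thesis using fC that(1) by (simp add: \<Psi>_C)
  qed
  have \<Psi>_comp: "\<Psi> p (\<Psi> q x) = \<Psi> (\<lambda>j. p j \<circ> q j) x"
    if "p \<in> carrier ?P" "q \<in> carrier ?P" "x \<in> L" for p q x
  proof (cases "x \<in> (\<Union>j. C j)")
    case True
    then obtain j where j: "x \<in> C j" by blast
    have "q j (g j x) \<in> {1..N j}" using gC[OF j] that(2) permutes_in_image by (metis carrier_P)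
    then show ?thesis using j \<Psi>_mem[OF j that(2)] by (simp add: \<Psi>_C)
  qed (use that in \<open>simp add: \<Psi>_out\<close>)
  have \<Psi>_id: "\<Psi> (\<lambda>j. id) x = x" if "x \<in> L" for x
    using that \<Psi>_C \<Psi>_out by (cases "x \<in> (\<Union>j. C j)") auto
  have \<Psi>_L: "\<Psi> p x \<in> L" if "x \<in> L" "p \<in> carrier ?P" for p x
  proof (cases "x \<in> (\<Union>j. C j)")
    case True
    then obtain j where "x \<in> C j" by blast
    then show ?thesis using \<Psi>_mem[OF _ that(2)] sub by blast
  qed (use that \<Psi>_out in auto)
  have \<Psi>_Bij: "\<Psi> p \<in> Bij L" if p: "p \<in> carrier ?P" for p
  proof -
    \<comment> \<open>The componentwise inverse provides a two-sided inverse of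
      \<open>\<Psi> p\<close>, by \<open>\<Psi>_comp\<close> and \<open>\<Psi>_id\<close>.\<close>
    let ?q = "\<lambda>j. inv' (p j)"
    have q: "?q \<in> carrier ?P" using p unfolding carrier_P by (simp add: permutes_inv)
    have "p j \<circ> ?q j = id" "?q j \<circ> p j = id" for j
      using p permutes_inv_o unfolding carrier_P by blast+
    then have "bij_betw (\<Psi> p) L L"
      using p q by (intro bij_betw_byWitness[where f' = "\<Psi> ?q"]) (auto simp: \<Psi>_comp \<Psi>_id intro: \<Psi>_L)
    then show ?thesis by (simp add: Bij_def \<Psi>_def)
  qed
  have carrier_I: "\<phi> \<in> carrier ?I \<longleftrightarrow>
    \<phi> \<in> Bij L \<and> (\<forall>x\<in>L - (\<Union>j. C j). \<phi> x = x) \<and> (\<forall>j. \<phi> ` C j = C j)" for \<phi>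
  proof -
    have "\<phi> \<in> carrier ?I \<longleftrightarrow> \<phi> \<in> Bij L \<and> (\<forall>u\<in>L. \<forall>v\<in>L. d (\<phi> u) (\<phi> v) = d u v)"
      by (simp add: isom_group_def BijGroup_def)
    then show ?thesis using char[of \<phi>] by blast
  qed
  have \<Psi>_I: "\<Psi> p \<in> carrier ?I" if p: "p \<in> carrier ?P" for p
  proof -
    have "\<Psi> p ` C j = C j" for j
    proof (rule card_subset_eq[OF fin])
      show "\<Psi> p ` C j \<subseteq> C j" using \<Psi>_mem p by blast
      have "inj_on (\<Psi> p) (C j)"
        using \<Psi>_Bij[OF p] sub by (auto simp: Bij_def bij_betw_def intro: inj_on_subset)
      then show "card (\<Psi> p ` C j) = card (C j)" by (rule card_image)
    qed
    then show ?thesis using \<Psi>_Bij[OF p] \<Psi>_out by (simp add: carrier_I)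
  qed
  have "\<Psi> \<in> hom ?P ?I"
  proof (rule homI)
    fix p q assume pq: "p \<in> carrier ?P" "q \<in> carrier ?P"
    then have "\<Psi> (p \<otimes>\<^bsub>?P\<^esub> q) = \<Psi> (\<lambda>j. p j \<circ> q j)" by (simp add: sym_group_def restrict_def)
    also have "\<dots> = compose L (\<Psi> p) (\<Psi> q)"
      using pq by (intro ext) (simp add: compose_def restrict_def \<Psi>_comp, simp add: \<Psi>_def)
    also have "\<dots> = \<Psi> p \<otimes>\<^bsub>?I\<^esub> \<Psi> q"
      using pq \<Psi>_Bij by (simp add: isom_group_def BijGroup_def)
    finally show "\<Psi> (p \<otimes>\<^bsub>?P\<^esub> q) = \<Psi> p \<otimes>\<^bsub>?I\<^esub> \<Psi> q" .
  qed (use \<Psi>_I in blast)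
  moreover have "bij_betw \<Psi> (carrier ?P) (carrier ?I)"
  proof (rule bij_betwI')
    fix p q assume pq: "p \<in> carrier ?P" "q \<in> carrier ?P"
    have "p = q" if eq: "\<Psi> p = \<Psi> q"
    proof (intro ext)
      fix j i
      show "p j i = q j i"
      proof (cases "i \<in> {1..N j}")
        case True
        then have "p j i \<in> {1..N j}" "q j i \<in> {1..N j}"
          using pq permutes_in_image by (metis carrier_P)+
        then show ?thesis using eq \<Psi>_C[OF fC[OF True], of p] \<Psi>_C[OF fC[OF True], of q] True
          by (metis gf)
      next
        case False
        then show ?thesis using pq permutes_not_in by (metis carrier_P)
      qed
    qed
    then show "\<Psi> p = \<Psi> q \<longleftrightarrow> p = q" by blast
  next
    fix \<phi> assume \<phi>: "\<phi> \<in> carrier ?I"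
    \<comment> \<open>The preimage of \<phi> is its conjugate under the numberings, extended by the
      identity as \<open>permutes\<close> demands.\<close>
    define p where "p j i = (if i \<in> {1..N j} then g j (\<phi> (f j i)) else i)" for j i
    have \<phi>_bij: "bij_betw \<phi> (C j) (C j)" for j
      using \<phi> sub by (auto simp: carrier_I Bij_def bij_betw_def intro: inj_on_subset)
    have "p j permutes {1..N j}" for j
    proof (rule bij_imp_permutes)
      have "bij_betw (g j \<circ> (\<phi> \<circ> f j)) {1..N j} {1..N j}"
        by (intro bij_betw_trans[OF _ g] bij_betw_trans[OF f \<phi>_bij])
      then show "bij_betw (p j) {1..N j} {1..N j}"
        by (rule bij_betw_cong[THEN iffD1, rotated]) (auto simp: p_def)
    qed (auto simp: p_def)
    then have "p \<in> carrier ?P" unfolding carrier_P by blast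
    moreover have "\<phi> x = \<Psi> p x" for x
    proof -
      consider j where "x \<in> C j" | "x \<in> L - (\<Union>j. C j)" | "x \<notin> L" using sub by blast
      then show ?thesis
      proof cases
        case (1 j)
        then have "\<phi> x \<in> C j" using \<phi>_bij bij_betwE by blast
        then show ?thesis using 1 gC[OF 1] by (simp add: \<Psi>_C p_def)
      next
        case 2
        then show ?thesis using \<phi> by (simp add: \<Psi>_out carrier_I)
      next
        case 3
        then show ?thesis using \<phi> by (auto simp: \<Psi>_def carrier_I Bij_def extensional_def)
      qed
    qed
    ultimately show "\<exists>p\<in>carrier ?P. \<phi> = \<Psi> p" by blast
  qed (rule \<Psi>_I)
  ultimately have "?P \<cong> ?I" by (intro is_isoI isoI)
  moreover have "group ?P" by (simp add: sym_group_is_group)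
  ultimately show ?thesis by (simp add: group.iso_sym)
qed

section \<open>The language and its isometries\<close>

text \<open>This is the square of \<open>4 * M\<close>: a level with \<open>4 * M\<close> free
  letters sits at a length whose square root is about \<open>4 * M\<close>. The gap of
  \<open>32 * M + 16\<close> to the next level leaves room for the remaining letters of a
  word.\<close>

abbreviation base :: "nat \<Rightarrow> nat" where "base M \<equiv> 16 * M ^ 2"

lemma base_Suc: "base (Suc M) = base M + 32 * M + 16"
  by (simp add: power2_eq_square)

lemma le_base: "M \<le> base M"
  by (cases M) (simp_all add: power2_eq_square)

lemma base_gap:
  assumes "M < M'"
  shows "base M + 32 * M + 16 \<le> base M'"
proof -
  have "base (Suc M) \<le> base M'" using assms by (simp add: power_mono)
  then show ?thesis by (simp add: base_Suc)
qed

lemma base_gap':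
  assumes "M < M'"
  shows "base M + 32 * M' \<le> base M' + 16"
proof -
  obtain K where K: "M' = Suc K" "M \<le> K" using assms by (cases M') auto
  then have "base M \<le> base K" by (simp add: power_mono)
  then show ?thesis using base_Suc[of K] K by simp
qed

text \<open>An offset below the gap to the next level cannot reach it. This lets the length of a
  word reveal its level.\<close>

lemma base_level_unique:
  assumes "base M + r = base M' + r'" "r < 32 * M + 16" "r' < 32 * M' + 16"
  shows "M = M'"
  using assms base_gap[of M M'] base_gap[of M' M] by (cases M M' rule: linorder_cases) linarith+

text \<open>The two runs of \<open>a\<close> are long enough to absorb the runs around the mark in
  clusters of the same or lower level. The leading \<open>b\<close> prevents the core from starting
  inside a run of \<open>a\<close>.\<close>

definition core :: "'a \<Rightarrow> 'a \<Rightarrow> nat \<Rightarrow> 'a list \<Rightarrow> 'a list" where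
  "core a b m w = b # replicate (base m) a @ b # replicate m a @ w"

text \<open>The sequence \<open>e\<close> lists the cores of all fillers, and \<open>v j\<close> is
  a word as in \<open>avoiding_supersequence\<close> for \<open>e j\<close>. The bound on
  \<open>m0\<close> isolates the empty word, and \<open>2 \<le> N j\<close> provides each cluster
  word with a close companion.\<close>

locale marked_language = weighted_lev A \<gamma> \<theta> for A :: "'a set" and \<gamma> \<theta> +
  fixes a b :: 'a and m0 :: nat and N :: "nat \<Rightarrow> nat" and e v :: "nat \<Rightarrow> 'a list" and \<sigma> :: "nat \<Rightarrow> nat"
  assumes ab: "a \<in> A" "b \<in> A" "a \<noteq> b" and fin: "finite A"
    and m0: "1 \<le> m0" "2 * \<gamma> + 2 * \<theta> < \<gamma> * real m0"
    and N: "\<And>j. 2 \<le> N j"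
    and e: "range e = {core a b m w | m w. m0 \<le> m \<and> w \<in> lists A \<and> length w = 4 * m}"
    and v_lists: "\<And>j. v j \<in> lists A"
    and not_subseq_v: "\<And>j. \<not> subseq (e j) (v j)"
    and subseq_v: "\<And>j y. y \<in> lists A \<Longrightarrow> length y = length (e j) \<Longrightarrow> y \<noteq> e j \<Longrightarrow> subseq y (v j)"
    and \<sigma>: "\<And>j. m0 \<le> \<sigma> j" "\<And>j. N j \<le> \<sigma> j" "\<And>j. length (v j) \<le> \<sigma> j"
    and \<sigma>_Suc: "\<And>j. \<sigma> j + 2 + N (Suc j) \<le> \<sigma> (Suc j)"
begin

definition mark :: "nat \<Rightarrow> nat \<Rightarrow> 'a list" where
  "mark M i = replicate (base M - i) a @ b # replicate i a"

text \<open>The outer letters \<open>b\<close> are matched with the mark and the last letter of a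
  reference, which leaves the core to be compared with \<open>v j\<close>. The final
  \<open>b\<close> also gives short fillers the form required by
  \<open>lev_short_mark\<close>.\<close>

definition filler :: "nat \<Rightarrow> 'a list \<Rightarrow> 'a list" where
  "filler m w = b # core a b m w @ [b]"

text \<open>The positions of the mark in a cluster are larger than those in all shorter clusters
  (see \<open>\<sigma>_Suc\<close>), so that words of a shorter cluster are subsequences of words of a longer one.\<close>

definition cluster :: "nat \<Rightarrow> 'a list set" where
  "cluster j = mark (\<sigma> j) ` {\<sigma> j - N j..<\<sigma> j}"

text \<open>The subtractions do not truncate (see \<open>ref_room\<close>); the length is \<open>base (Suc (\<sigma> j)) + 1 + s\<close>.
  Since \<open>ref j 0\<close> and \<open>ref j 1\<close> are at distance \<open>\<gamma>\<close>, neither of them is isolated.\<close>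

definition ref :: "nat \<Rightarrow> nat \<Rightarrow> 'a list" where
  "ref j s = replicate (base (Suc (\<sigma> j)) - Suc (\<sigma> j) - length (v j) - 1 + s) a @
    b # replicate (Suc (\<sigma> j)) a @ v j @ [b]"

definition lang :: "'a list set" where
  "lang = {[]} \<union> {filler m w | m w. m0 \<le> m \<and> w \<in> lists A \<and> length w = 4 * m} \<union>
    (\<Union>j. cluster j) \<union> {ref j s | j s. s \<le> 1}"

lemma lang_cases [consumes 1, case_names Nil filler mark ref]:
  assumes "x \<in> lang"
  obtains "x = []"
    | m w where "x = filler m w" "m0 \<le> m" "w \<in> lists A" "length w = 4 * m"
    | j i where "x = mark (\<sigma> j) i" "\<sigma> j - N j \<le> i" "i < \<sigma> j" "x \<in> cluster j"
    | j s where "x = ref j s" "s \<le> 1"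
proof -
  have "(\<exists>i. x = mark (\<sigma> j) i \<and> \<sigma> j - N j \<le> i \<and> i < \<sigma> j)" if "x \<in> cluster j" for j
    using that by (auto simp: cluster_def)
  then show ?thesis using assms that unfolding lang_def by blast
qed

lemma \<sigma>_less: "i < j \<Longrightarrow> \<sigma> i + 2 + N j \<le> \<sigma> j"
proof (induction j)
  case (Suc j)
  then show ?case using \<sigma>_Suc[of j] by (cases "i = j") auto
qed simp

lemma \<sigma>_inj: "\<sigma> i = \<sigma> j \<longleftrightarrow> i = j"
  using \<sigma>_less[of i j] \<sigma>_less[of j i] by (cases i j rule: linorder_cases) auto

text \<open>Distinct values of \<sigma> differ by more than one, so references, placed at level
  \<open>Suc (\<sigma> j)\<close>, never share a level with a cluster.\<close>

lemma \<sigma>_neq_Suc: "\<sigma> i \<noteq> Suc (\<sigma> j)"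
  using \<sigma>_less[of i j] \<sigma>_less[of j i] by (cases i j rule: linorder_cases) auto

lemma length_mark: "i \<le> M \<Longrightarrow> length (mark M i) = base M + 1"
  using le_base[of M] by (simp add: mark_def)

lemma length_filler: "length w = 4 * m \<Longrightarrow> length (filler m w) = base m + 5 * m + 4"
  by (simp add: filler_def core_def)

lemma ref_room: "base (\<sigma> j) \<le> base (Suc (\<sigma> j)) - Suc (\<sigma> j) - length (v j) - 1"
  "Suc (\<sigma> j) + length (v j) + 1 \<le> base (Suc (\<sigma> j))"
proof -
  have "base (Suc (\<sigma> j)) = base (\<sigma> j) + 32 * \<sigma> j + 16" by (rule base_Suc)
  with \<sigma>(3)[of j]
  show "base (\<sigma> j) \<le> base (Suc (\<sigma> j)) - Suc (\<sigma> j) - length (v j) - 1"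
    "Suc (\<sigma> j) + length (v j) + 1 \<le> base (Suc (\<sigma> j))" by linarith+
qed

lemma length_ref: "length (ref j s) = base (Suc (\<sigma> j)) + 1 + s"
proof -
  have "length (ref j s) =
    base (Suc (\<sigma> j)) - Suc (\<sigma> j) - length (v j) - 1 + s + 1 + Suc (\<sigma> j) + length (v j) + 1"
    by (simp add: ref_def)
  then show ?thesis using ref_room(2)[of j] by linarith
qed

lemma filler_lang: "m0 \<le> m \<Longrightarrow> w \<in> lists A \<Longrightarrow> length w = 4 * m \<Longrightarrow> filler m w \<in> lang"
  unfolding lang_def by blast

lemma cluster_lang: "cluster j \<subseteq> lang" unfolding lang_def by blast

lemma ref_lang: "s \<le> 1 \<Longrightarrow> ref j s \<in> lang" unfolding lang_def by blast

lemma lang_lists: "lang \<subseteq> lists A"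
proof
  fix x assume "x \<in> lang"
  then show "x \<in> lists A"
    using ab v_lists by (cases rule: lang_cases) (auto simp: filler_def core_def mark_def ref_def in_lists_conv_set)
qed

lemma in_lists: "x \<in> lang \<Longrightarrow> x \<in> lists A" using lang_lists by blast

lemma mark_inj: "i \<le> M \<Longrightarrow> i' \<le> M \<Longrightarrow> mark M i = mark M i' \<longleftrightarrow> i = i'"
proof
  assume "i \<le> M" "i' \<le> M" and eq: "mark M i = mark M i'"
  then have le: "i \<le> base M" "i' \<le> base M" using le_base[of M] by linarith+
  have tw: "length (takeWhile (\<lambda>x. x = a) (mark M k)) = base M - k" for k
    using ab by (simp add: mark_def takeWhile_append)
  from tw[of i] tw[of i'] eq le show "i = i'" by simp
qed simp

lemma finite_cluster: "finite (cluster j)" and card_cluster: "card (cluster j) = N j"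
proof -
  have "inj_on (mark (\<sigma> j)) {\<sigma> j - N j..<\<sigma> j}" by (auto simp: inj_on_def mark_inj)
  then show "card (cluster j) = N j" using \<sigma>(2)[of j] by (simp add: cluster_def card_image)
qed (simp add: cluster_def)

lemma length_cluster: "c \<in> cluster j \<Longrightarrow> length c = base (\<sigma> j) + 1"
  by (auto simp: cluster_def length_mark)

lemma cluster_disjoint: "i \<noteq> j \<Longrightarrow> cluster i \<inter> cluster j = {}"
proof -
  have "i = j" if "c \<in> cluster i" "c \<in> cluster j" for c
    using base_level_unique[of "\<sigma> i" 1 "\<sigma> j" 1] that[THEN length_cluster] \<sigma>_inj by simp
  then show "i \<noteq> j \<Longrightarrow> cluster i \<inter> cluster j = {}" by blast
qed

text \<open>The length determines the level; at level \<open>\<sigma> j\<close> a filler has an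
  offset larger than 1, and no reference occurs.\<close>

lemma same_length_mark:
  assumes "x \<in> lang" "length x = base (\<sigma> j) + 1"
  shows "x \<in> cluster j"
  using assms(1)
proof (cases rule: lang_cases)
  case (filler m w)
  then show ?thesis using base_level_unique[of m "5 * m + 4" "\<sigma> j" 1] assms(2) length_filler[of w m] by simp
next
  case (mark j' i)
  then show ?thesis
    using base_level_unique[of "\<sigma> j'" 1 "\<sigma> j" 1] assms(2) \<sigma>_inj length_mark[of i "\<sigma> j'"] by simp
next
  case (ref j' s)
  then show ?thesis
    using base_level_unique[of "Suc (\<sigma> j')" "1 + s" "\<sigma> j" 1] assms(2) \<sigma>_neq_Suc[of j j'] length_ref[of j' s] by simp
qed (use assms(2) in simp)

lemma same_length_ref:
  assumes "x \<in> lang" "length x = length (ref j s)" "s \<le> 1"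
  shows "x = ref j s"
  using assms(1)
proof (cases rule: lang_cases)
  case (filler m w)
  then show ?thesis
    using base_level_unique[of m "5 * m + 4" "Suc (\<sigma> j)" "1 + s"] assms(2,3) length_filler[of w m] length_ref[of j s]
    by simp
next
  case (mark j' i)
  then show ?thesis
    using base_level_unique[of "\<sigma> j'" 1 "Suc (\<sigma> j)" "1 + s"] assms(2,3) \<sigma>_neq_Suc[of j' j]
      length_mark[of i "\<sigma> j'"] length_ref[of j s] by simp
next
  case (ref j' s')
  then show ?thesis
    using base_level_unique[of "Suc (\<sigma> j')" "1 + s'" "Suc (\<sigma> j)" "1 + s"] assms(2,3) \<sigma>_inj
      length_ref[of j s] length_ref[of j' s'] by simp
qed (use assms(2) length_ref[of j s] in simp)

lemma same_length_filler:
  assumes "x \<in> lang" "length x = base m + 5 * m + 4"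
  obtains w where "x = filler m w" "w \<in> lists A" "length w = 4 * m"
  using assms(1)
proof (cases rule: lang_cases)
  case (filler m' w)
  then show ?thesis
    using base_level_unique[of m "5 * m + 4" m' "5 * m' + 4"] assms(2) length_filler[of w m'] that by simp
next
  case (mark j i)
  then show ?thesis
    using base_level_unique[of m "5 * m + 4" "\<sigma> j" 1] assms(2) length_mark[of i "\<sigma> j"] by simp
next
  case (ref j s)
  then show ?thesis
    using base_level_unique[of m "5 * m + 4" "Suc (\<sigma> j)" "1 + s"] assms(2) length_ref[of j s] by simp
qed (use assms(2) in simp)

section \<open>Distances between clusters and the other words\<close>

lemma subseq_replicate: "i \<le> j \<Longrightarrow> subseq (replicate i c) (replicate j c @ y)"
  by (metis le_add_diff_inverse replicate_add append_assoc prefix_imp_subseq prefixI)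

lemma mark_subseq_filler:
  assumes "M \<le> m" "i \<le> M"
  shows "subseq (mark M i) (filler m w)"
proof -
  have "base M \<le> base m" using assms by (simp add: power_mono)
  then have "base M - i \<le> base m" by linarith
  then have "subseq (replicate (base M - i) a @ b # replicate i a)
    (replicate (base m) a @ b # replicate m a @ w @ [b])"
    using subseq_replicate[of "base M - i" "base m" a "[]"] subseq_replicate[of i m a "w @ [b]"] assms
    by (intro list_emb_append_mono) auto
  then show ?thesis unfolding filler_def core_def mark_def by auto
qed

lemma mark_subseq_ref:
  assumes "M \<le> \<sigma> j" "i \<le> M"
  shows "subseq (mark M i) (ref j s)"
proof -
  have "base M \<le> base (\<sigma> j)" using assms by (simp add: power_mono)
  then have "base M - i \<le> base (Suc (\<sigma> j)) - Suc (\<sigma> j) - length (v j) - 1 + s"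
    using ref_room(1)[of j] by linarith
  moreover have "subseq (b # replicate i a) (b # replicate (Suc (\<sigma> j)) a @ v j @ [b])"
    using subseq_replicate[of i "Suc (\<sigma> j)" a "v j @ [b]"] assms by simp
  ultimately show ?thesis unfolding ref_def mark_def
    using subseq_replicate[of _ _ a "[]"] by (intro list_emb_append_mono) auto
qed

lemma mark_subseq_mark:
  assumes "base M - i \<le> base M' - i'" "i \<le> i'"
  shows "subseq (mark M i) (mark M' i')"
  unfolding mark_def
  using assms subseq_replicate[of _ _ a "[]"] by (intro list_emb_append_mono) auto

text \<open>In the formula of \<open>lev_one_mark\<close> the position of the mark enters only
  through \<open>s + i\<close>, which equals \<open>base M\<close> for both words.\<close>

lemma lev_short_mark:
  assumes "u \<in> lists A" "length u + M \<le> base M" "i \<le> M" "i' \<le> M"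
  shows "d (u @ [b]) (mark M i) = d (u @ [b]) (mark M i')"
  using lev_one_mark[OF assms(1) ab, of "base M - i" i] lev_one_mark[OF assms(1) ab, of "base M - i'" i']
    assms le_base[of M] by (simp add: mark_def of_nat_diff)

text \<open>The word \<open>x\<close> contains both \<open>c\<close> and \<open>c'\<close>, or is
  contained in both, or is a short word ending in \<open>b\<close>. In the first two cases the
  distance is given by the lengths, in the third by \<open>lev_short_mark\<close>.\<close>

lemma cluster_twins:
  assumes "c \<in> cluster j" "c' \<in> cluster j" "x \<in> lang" "x \<notin> cluster j"
  shows "d c x = d c' x"
proof -
  obtain i where i: "c = mark (\<sigma> j) i" "\<sigma> j - N j \<le> i" "i < \<sigma> j"
    using assms(1) by (auto simp: cluster_def)
  obtain i' where i': "c' = mark (\<sigma> j) i'" "\<sigma> j - N j \<le> i'" "i' < \<sigma> j"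
    using assms(2) by (auto simp: cluster_def)
  have len: "length c = length c'" using assms(1,2) by (simp add: length_cluster)
  have c_lists: "c \<in> lists A" "c' \<in> lists A" using assms cluster_lang in_lists by blast+
  note x_lists = in_lists[OF assms(3)]
  consider "subseq c x" "subseq c' x" | "subseq x c" "subseq x c'"
    | u where "x = u @ [b]" "length u + \<sigma> j \<le> base (\<sigma> j)"
    using assms(3)
  proof (cases rule: lang_cases)
    case Nil
    then show ?thesis using that by simp
  next
    case (filler m w)
    show ?thesis
    proof (cases "\<sigma> j \<le> m")
      case True
      then show ?thesis using that(1) filler i i' mark_subseq_filler by simp
    next
      case False
      have "length x = length (b # core a b m w) + 1" using filler by (simp add: filler_def)
      then show ?thesis
        using that(3)[of "b # core a b m w"] filler(1) length_filler[OF filler(4)] base_gap'[of m "\<sigma> j"] False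
          base_gap[of m "\<sigma> j"]
        by (simp add: filler_def)
    qed
  next
    case (mark j' l)
    then have "j' \<noteq> j" using assms(4) by blast
    then consider "j < j'" | "j' < j" by linarith
    then show ?thesis
    proof cases
      case 1
      \<comment> \<open>Both runs of \<open>a\<close> in the longer word exceed those of the shorter
        ones: its positions start at \<open>\<sigma> j' - N j'\<close>, beyond
        \<open>\<sigma> j\<close>.\<close>
      have "base (\<sigma> j) \<le> base (\<sigma> j') - l" "\<sigma> j \<le> l"
        using \<sigma>_less[OF 1] base_gap'[of "\<sigma> j" "\<sigma> j'"] mark \<sigma>(1)[of j'] m0(1) by linarith+
      then show ?thesis using that(1) mark(1) i i' by (simp add: mark_subseq_mark)
    next
      case 2
      have *: "base (\<sigma> j') \<le> base (\<sigma> j) - \<sigma> j" "l \<le> \<sigma> j - N j"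
        using \<sigma>_less[OF 2] base_gap'[of "\<sigma> j'" "\<sigma> j"] mark \<sigma>(1)[of j] m0(1) by linarith+
      have "subseq x (mark (\<sigma> j) k)" if "\<sigma> j - N j \<le> k" "k < \<sigma> j" for k
        using * that mark(1) by (simp add: mark_subseq_mark)
      then show ?thesis using that(2) i i' by blast
    qed
  next
    case (ref j' s)
    show ?thesis
    proof (cases "\<sigma> j \<le> \<sigma> j'")
      case True
      then show ?thesis using that(1) ref i i' mark_subseq_ref by simp
    next
      case False
      \<comment> \<open>The level of the reference is strictly below that of the cluster, so a whole
        gap separates their lengths.\<close>
      then have "Suc (\<sigma> j') < \<sigma> j" using \<sigma>_neq_Suc[of j j'] by linarith
      moreover obtain u where u: "x = u @ [b]" using ref(1) by (auto simp: ref_def)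
      moreover from u ref have "length u + 1 = base (Suc (\<sigma> j')) + 1 + s"
        using length_ref[of j' s] by simp
      ultimately show ?thesis using that(3)[of u] base_gap'[of "Suc (\<sigma> j')" "\<sigma> j"] ref(2) by linarith
    qed
  qed
  then show ?thesis
  proof cases
    case 1
    then show ?thesis using lev_subseq x_lists len by simp
  next
    case 2
    then show ?thesis using lev_subseq c_lists len lev_sym[of _ x] by simp
  next
    case (3 u)
    then show ?thesis
      using lev_short_mark[of u "\<sigma> j" i i'] i i' x_lists lev_sym[of _ x] by simp
  qed
qed

lemma cluster_equidistant:
  assumes "c \<in> cluster j" "c' \<in> cluster j" "c \<noteq> c'"
  shows "d c c' = min (2 * \<gamma>) (2 * \<theta>)"
proof -
  obtain i i' where i: "c = mark (\<sigma> j) i" "c' = mark (\<sigma> j) i'" "i < \<sigma> j" "i' < \<sigma> j"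
    using assms(1,2) by (auto simp: cluster_def)
  then have "i \<noteq> i'" using assms(3) by blast
  then show ?thesis using lev_shift_mark[OF ab, of "base (\<sigma> j) - i" i "base (\<sigma> j) - i'" i'] i
      le_base[of "\<sigma> j"] by (simp add: mark_def)
qed

section \<open>Rigidity outside the clusters\<close>

lemma lev_Nil_lang: "x \<in> lang \<Longrightarrow> d [] x = \<gamma> * real (length x)"
  using in_lists lev_Nil by blast

lemma Nil_isolated:
  assumes "x \<in> lang" "x \<noteq> []"
  shows "2 * \<gamma> + 2 * \<theta> < d [] x"
proof -
  have "m0 \<le> length x"
    using assms(1)
  proof (cases rule: lang_cases)
    case (filler m w)
    then show ?thesis using length_filler[of w m] by simp
  next
    case (mark j i)
    then have "length x = base (\<sigma> j) + 1" using length_cluster by blast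
    then show ?thesis using \<sigma>(1)[of j] le_base[of "\<sigma> j"] by linarith
  next
    case (ref j s)
    then have "length x = base (Suc (\<sigma> j)) + 1 + s" using length_ref by blast
    then show ?thesis using \<sigma>(1)[of j] le_base[of "Suc (\<sigma> j)"] by linarith
  qed (use assms in simp)
  then have "\<gamma> * real m0 \<le> \<gamma> * real (length x)" using pos by simp
  then show ?thesis using lev_Nil_lang[OF assms(1)] m0(2) by linarith
qed

text \<open>One letter of a filler is replaced, a cluster has a second word, and the two references
  with the same \<open>j\<close> differ by one insertion. The common bound exceeds all three costs
  and is the one violated in \<open>Nil_isolated\<close>.\<close>

lemma neighbour:
  assumes "x \<in> lang" "x \<noteq> []"
  obtains y where "y \<in> lang" "y \<noteq> []" "y \<noteq> x" "d x y \<le> 2 * \<gamma> + 2 * \<theta>"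
  using assms(1)
proof (cases rule: lang_cases)
  case (filler m w)
  then obtain l w' where w: "w = l # w'" using m0(1) by (cases w) auto
  obtain l' where l': "l' \<in> A" "l' \<noteq> l" using ab by metis
  let ?p = "b # b # replicate (base m) a @ b # replicate m a" and ?y = "filler m (l' # w')"
  have x: "x = ?p @ l # w' @ [b]" and y: "?y = ?p @ l' # w' @ [b]"
    using filler(1) w by (simp_all add: filler_def core_def)
  have "edits A 0 0 x x" using in_lists[OF assms(1)] by (rule edits_refl)
  then have "edits A 0 (Suc 0) x ?y" unfolding y using x l'(1) by (metis edits_replace)
  from lev_leI[OF this] pos have "d x ?y \<le> 2 * \<gamma> + 2 * \<theta>" by simp
  moreover have "?y \<in> lang" using filler w l'(1) by (intro filler_lang) simp_all
  moreover have "?y \<noteq> x" using x y l'(2) by simp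
  moreover have "?y \<noteq> []" by (simp add: filler_def)
  ultimately show thesis by (intro that)
next
  case (mark j i)
  have "\<not> cluster j \<subseteq> {x}"
  proof
    assume "cluster j \<subseteq> {x}"
    then have "card (cluster j) \<le> card {x}" by (intro card_mono) simp_all
    then show False using card_cluster[of j] N[of j] by simp
  qed
  then obtain y where y: "y \<in> cluster j" "y \<noteq> x" by blast
  then have "d x y \<le> 2 * \<gamma> + 2 * \<theta>" using cluster_equidistant[OF mark(4) y(1)] pos by simp
  moreover have "y \<noteq> []" using length_cluster[OF y(1)] by auto
  moreover have "y \<in> lang" using y(1) cluster_lang by (rule rev_subsetD)
  ultimately show thesis using y(2) by (intro that)
next
  case (ref j s)
  have mem: "ref j 0 \<in> lang" "ref j 1 \<in> lang" by (simp_all add: ref_lang)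
  have neq: "ref j 0 \<noteq> ref j 1" "ref j 0 \<noteq> []" "ref j 1 \<noteq> []"
    using length_ref[of j 0] length_ref[of j 1] by (auto dest: arg_cong[of _ _ length])
  have "ref j 1 = a # ref j 0" by (simp add: ref_def)
  then have "subseq (ref j 0) (ref j 1)" by auto
  then have "d (ref j 0) (ref j 1) = \<gamma>" using lev_subseq in_lists[OF mem(2)] length_ref by simp
  then have "d (ref j 0) (ref j 1) \<le> 2 * \<gamma> + 2 * \<theta>" "d (ref j 1) (ref j 0) \<le> 2 * \<gamma> + 2 * \<theta>"
    using pos lev_sym[of "ref j 1"] by simp_all
  moreover have "s = 0 \<or> s = 1" using ref(2) by auto
  ultimately show thesis using that mem neq ref(1) by metis
qed (use assms in simp)

text \<open>Greedy matching: the first \<open>b\<close> of the filler skips the initial run of the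
  reference and takes its mark, the \<open>b\<close> opening the core skips the next run, and the
  final letters cancel. What remains is the core against \<open>v j\<close>.\<close>

lemma filler_subseq_ref_iff:
  assumes "e j = core a b m w" "w' \<in> lists A" "length w' = length w"
  shows "subseq (filler m w') (ref j 0) \<longleftrightarrow> w' \<noteq> w"
proof -
  have "subseq (filler m w') (ref j 0) \<longleftrightarrow> subseq (core a b m w' @ [b]) (replicate (Suc (\<sigma> j)) a @ v j @ [b])"
    unfolding filler_def ref_def using ab subseq_Cons_skip[of b "replicate _ a"] by auto
  also have "\<dots> \<longleftrightarrow> subseq (core a b m w' @ [b]) (v j @ [b])"
    unfolding core_def append_Cons using ab by (intro subseq_Cons_skip) auto
  also have "\<dots> \<longleftrightarrow> subseq (core a b m w') (v j)" by simp
  also have "\<dots> \<longleftrightarrow> w' \<noteq> w"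
  proof (cases "w' = w")
    case True
    then show ?thesis using not_subseq_v[of j] assms(1) by simp
  next
    case False
    then have "core a b m w' \<in> lists A" "length (core a b m w') = length (e j)" "core a b m w' \<noteq> e j"
      using assms ab by (auto simp: core_def in_lists_conv_set)
    then show ?thesis using False subseq_v by simp
  qed
  finally show ?thesis .
qed

text \<open>Once the empty word is fixed, distances to it show that lengths are preserved. Lengths
  single out the clusters and every reference; fillers of equal length are told apart by the
  references that contain them.\<close>

lemma isometry_fixes:
  assumes \<phi>: "\<phi> \<in> Bij lang" and iso: "\<And>u v. u \<in> lang \<Longrightarrow> v \<in> lang \<Longrightarrow> d (\<phi> u) (\<phi> v) = d u v"
  shows "x \<in> lang \<Longrightarrow> x \<notin> (\<Union>j. cluster j) \<Longrightarrow> \<phi> x = x" and "\<phi> ` cluster j = cluster j"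
proof -
  have bij: "bij_betw \<phi> lang lang" using \<phi> by (simp add: Bij_def)
  then have mem: "\<phi> x \<in> lang" if "x \<in> lang" for x using that by (rule bij_betw_apply)
  have inj: "inj_on \<phi> lang" using bij by (simp add: bij_betw_def)
  have Nil: "[] \<in> lang" by (simp add: lang_def)
  have "\<phi> [] = []"
  proof (rule ccontr)
    assume ne: "\<phi> [] \<noteq> []"
    \<comment> \<open>The preimage of a close neighbour of \<open>\<phi> []\<close> would be a close
      neighbour of the empty word.\<close>
    obtain y where y: "y \<in> lang" "y \<noteq> \<phi> []" "d (\<phi> []) y \<le> 2 * \<gamma> + 2 * \<theta>"
      using neighbour[OF mem[OF Nil] ne] by metis
    obtain z where z: "z \<in> lang" "y = \<phi> z" using bij y(1) by (metis bij_betw_imp_surj_on imageE)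
    then have "z \<noteq> []" using y(2) by blast
    then show False using Nil_isolated[OF z(1)] iso[OF Nil z(1)] y(3) z(2) by simp
  qed
  then have len: "length (\<phi> x) = length x" if "x \<in> lang" for x
    using iso[OF Nil that] lev_Nil_lang[OF that] lev_Nil_lang[OF mem[OF that]] pos by simp
  have ref: "\<phi> (ref j s) = ref j s" if "s \<le> 1" for j s
  proof -
    have "ref j s \<in> lang" using that by (rule ref_lang)
    then show ?thesis using same_length_ref mem len that by simp
  qed
  show "\<phi> ` cluster j = cluster j"
  proof (rule card_subset_eq[OF finite_cluster])
    show "\<phi> ` cluster j \<subseteq> cluster j"
    proof
      fix y assume "y \<in> \<phi> ` cluster j"
      then obtain c where c: "c \<in> cluster j" "y = \<phi> c" by blast
      then have "c \<in> lang" using cluster_lang by blast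
      then have "length y = base (\<sigma> j) + 1" using c len length_cluster by simp
      then show "y \<in> cluster j" using c(2) mem[OF \<open>c \<in> lang\<close>] by (intro same_length_mark) simp_all
    qed
    show "card (\<phi> ` cluster j) = card (cluster j)"
      using inj cluster_lang by (intro card_image) (rule inj_on_subset)
  qed
  assume x: "x \<in> lang" "x \<notin> (\<Union>j. cluster j)"
  show "\<phi> x = x"
    using x(1)
  proof (cases rule: lang_cases)
    case (filler m w)
    have "length (\<phi> x) = base m + 5 * m + 4" using len[OF x(1)] length_filler[OF filler(4)] filler(1) by simp
    then obtain w' where w': "\<phi> x = filler m w'" "w' \<in> lists A" "length w' = 4 * m"
      using same_length_filler mem[OF x(1)] by blast
    \<comment> \<open>Since \<open>e\<close> lists all cores, some reference misses \<open>x\<close>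
      alone among the fillers of this length; as it is fixed, it misses \<open>\<phi> x\<close>
      too.\<close>
    have "core a b m w \<in> range e" unfolding e using filler by blast
    then obtain j where "core a b m w = e j" by (rule rangeE)
    then have j: "e j = core a b m w" ..
    let ?r = "ref j 0"
    have lists: "x \<in> lists A" "\<phi> x \<in> lists A" "?r \<in> lists A"
      using x(1) mem ref_lang in_lists by simp_all
    have "\<not> subseq x ?r" using filler_subseq_ref_iff[OF j filler(3)] filler(1) by simp
    then have "d x ?r > \<gamma> * (real (length ?r) - real (length x))"
      using lists by (intro lev_not_subseq)
    moreover have "d x ?r = d (\<phi> x) ?r" using iso[OF x(1) ref_lang[of 0 j]] ref[of 0 j] by simp
    ultimately have "\<not> subseq (\<phi> x) ?r" using lev_subseq[OF _ lists(3)] len[OF x(1)] by auto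
    then show ?thesis using filler_subseq_ref_iff[OF j w'(2)] w' filler by simp
  qed (use x ref \<open>\<phi> [] = []\<close> in auto)
qed

text \<open>For the converse, distances inside a cluster are constant, and by
  \<open>cluster_twins\<close> the two arguments of any other distance may be moved one after the
  other.\<close>

lemma isometry_iff:
  assumes \<phi>: "\<phi> \<in> Bij lang"
  shows "(\<forall>u\<in>lang. \<forall>v\<in>lang. d (\<phi> u) (\<phi> v) = d u v) \<longleftrightarrow>
    (\<forall>x\<in>lang - (\<Union>j. cluster j). \<phi> x = x) \<and> (\<forall>j. \<phi> ` cluster j = cluster j)"
proof (intro iffI ballI)
  assume iso: "\<forall>u\<in>lang. \<forall>v\<in>lang. d (\<phi> u) (\<phi> v) = d u v"
  note pts = isometry_fixes[OF \<phi> iso[rule_format]]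
  show "(\<forall>x\<in>lang - (\<Union>j. cluster j). \<phi> x = x) \<and> (\<forall>j. \<phi> ` cluster j = cluster j)"
  proof (intro conjI ballI allI)
    fix x assume "x \<in> lang - (\<Union>j. cluster j)"
    then show "\<phi> x = x" using pts(1)[of x] by (meson DiffD1 DiffD2)
  qed (rule pts(2))
next
  assume "(\<forall>x\<in>lang - (\<Union>j. cluster j). \<phi> x = x) \<and> (\<forall>j. \<phi> ` cluster j = cluster j)"
  then have out: "\<And>x. x \<in> lang \<Longrightarrow> (\<And>j. x \<notin> cluster j) \<Longrightarrow> \<phi> x = x"
    and clu: "\<And>x j. x \<in> cluster j \<Longrightarrow> \<phi> x \<in> cluster j"
    by blast+
  have inj: "inj_on \<phi> lang" and mem: "\<And>x. x \<in> lang \<Longrightarrow> \<phi> x \<in> lang"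
    using \<phi> by (auto simp: Bij_def bij_betw_def)
  have one: "d (\<phi> u) x = d u x" if u: "u \<in> lang" and x: "x \<in> lang" "\<And>j. u \<in> cluster j \<Longrightarrow> x \<notin> cluster j" for u x
  proof (cases "\<exists>j. u \<in> cluster j")
    case True
    then obtain j where "u \<in> cluster j" by blast
    then show ?thesis using cluster_twins[of "\<phi> u" j u x] clu x by blast
  qed (use out u in auto)
  fix u v assume uv: "u \<in> lang" "v \<in> lang"
  show "d (\<phi> u) (\<phi> v) = d u v"
  proof (cases "\<exists>j. u \<in> cluster j \<and> v \<in> cluster j")
    case True
    then obtain j where j: "u \<in> cluster j" "v \<in> cluster j" by blast
    show ?thesis
    proof (cases "u = v")
      case True
      have "d x x = 0" if "x \<in> lang" for x using lev_subseq[of x x] in_lists[OF that] by simp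
      then show ?thesis using True uv mem by simp
    next
      case False
      then have "\<phi> u \<noteq> \<phi> v" using inj uv by (auto dest: inj_onD)
      then show ?thesis
        using cluster_equidistant[OF j False] cluster_equidistant[OF clu[OF j(1)] clu[OF j(2)]] by simp
    qed
  next
    case False
    \<comment> \<open>The first argument is moved while the second is already
      \<open>\<phi> v\<close>, so this word must lie outside the cluster of
      \<open>u\<close>.\<close>
    have "\<phi> v \<notin> cluster j" if "u \<in> cluster j" for j
    proof
      assume *: "\<phi> v \<in> cluster j"
      show False
      proof (cases "\<exists>i. v \<in> cluster i")
        case True
        then obtain i where i: "v \<in> cluster i" by blast
        then have "i = j" using * clu cluster_disjoint[of i j] by blast
        then show False using i that False by blast
      next
        case False
        then have "\<phi> v = v" using out uv(2) by blast
        then show False using False * by simp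
      qed
    qed
    then have "d (\<phi> u) (\<phi> v) = d u (\<phi> v)" using one uv mem by simp
    also have "\<dots> = d u v" using one[OF uv(2) uv(1)] False lev_sym[of u] by auto
    finally show ?thesis .
  qed
qed

lemma isom_group_lang:
  "isom_group d lang \<cong> product_group (UNIV :: nat set) (\<lambda>j. sym_group (N j))"
  by (rule isom_group_iso_product_sym_group[OF finite_cluster card_cluster cluster_lang cluster_disjoint isometry_iff])

section \<open>Growth of the language\<close>

lemma growth_lang_ge:
  assumes "m0 \<le> m" "base m + 5 * m + 4 \<le> n"
  shows "card A ^ (4 * m) \<le> growth lang n"
proof -
  let ?W = "{w. set w \<subseteq> A \<and> length w = 4 * m}"
  have "inj_on (filler m) ?W" by (auto simp: inj_on_def filler_def core_def)
  then have card: "card (filler m ` ?W) = card A ^ (4 * m)"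
    using card_lists_length_eq[OF fin] by (simp add: card_image)
  have sub: "filler m ` ?W \<subseteq> {x \<in> lang. length x \<le> n}"
  proof
    fix x assume "x \<in> filler m ` ?W"
    then obtain w where w: "x = filler m w" "w \<in> lists A" "length w = 4 * m"
      by (auto simp: in_lists_conv_set)
    then show "x \<in> {x \<in> lang. length x \<le> n}"
      using assms filler_lang length_filler[OF w(3)] by simp
  qed
  have "finite {x \<in> lang. length x \<le> n}"
    by (rule finite_subset[OF _ finite_lists_length_le[OF fin, of n]])
      (use lang_lists in \<open>auto simp: in_lists_conv_set\<close>)
  from card_mono[OF this sub] show ?thesis by (simp add: card growth_def)
qed

text \<open>Level \<open>M\<close> has at most \<open>card A ^ (4 * M)\<close> fillers, one cluster
  of at most \<open>M\<close> words, and two references. The bounds grow geometrically, so the sum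
  up to level \<open>m\<close> is of the order of its last term.\<close>

lemma growth_lang_le:
  assumes "n < base (Suc m)" "2 \<le> card A"
  shows "growth lang n \<le> 9 * card A ^ (4 * m)"
proof -
  let ?k = "card A"
  define level where "level M = filler M ` {w. set w \<subseteq> A \<and> length w = 4 * M} \<union>
    (\<Union>j\<in>{j. \<sigma> j = M}. cluster j) \<union> (\<Union>j\<in>{j. Suc (\<sigma> j) = M}. {ref j 0, ref j 1})" for M
  \<comment> \<open>Injectivity of \<sigma> leaves at most one cluster on a level.\<close>
  have single: "{j. \<sigma> j = M} = {} \<or> (\<exists>j. {j. \<sigma> j = M} = {j} \<and> \<sigma> j = M)" for M
    using \<sigma>_inj by blast
  have clu: "finite (\<Union>j\<in>{j. \<sigma> j = M}. cluster j) \<and> card (\<Union>j\<in>{j. \<sigma> j = M}. cluster j) \<le> M" for M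
    using single[of M] finite_cluster card_cluster \<sigma>(2) by auto
  have single': "{j. Suc (\<sigma> j) = M} = {} \<or> (\<exists>j. {j. Suc (\<sigma> j) = M} = {j})" for M
  proof (cases "\<exists>j. Suc (\<sigma> j) = M")
    case True
    then obtain j where "Suc (\<sigma> j) = M" by blast
    then have "{j. Suc (\<sigma> j) = M} = {j}" using \<sigma>_inj by auto
    then show ?thesis by blast
  qed blast
  have refs: "finite (\<Union>j\<in>{j. Suc (\<sigma> j) = M}. {ref j 0, ref j 1}) \<and>
    card (\<Union>j\<in>{j. Suc (\<sigma> j) = M}. {ref j 0, ref j 1}) \<le> 2" for M
    using single'[of M] by (auto simp: card_insert_if)
  have fil: "finite (filler M ` {w. set w \<subseteq> A \<and> length w = 4 * M}) \<and>
    card (filler M ` {w. set w \<subseteq> A \<and> length w = 4 * M}) \<le> ?k ^ (4 * M)" for M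
  proof -
    have "finite {w. set w \<subseteq> A \<and> length w = 4 * M}" by (rule finite_lists_length_eq[OF fin])
    from card_image_le[OF this, of "filler M"] finite_imageI[OF this, of "filler M"]
    show ?thesis unfolding card_lists_length_eq[OF fin] by blast
  qed
  have level: "finite (level M) \<and> card (level M) \<le> 4 * (?k ^ 4) ^ M" for M
  proof -
    have "M < 2 ^ (4 * M)" using less_exp[of "4 * M"] by linarith
    also have "(2 :: nat) ^ (4 * M) \<le> ?k ^ (4 * M)" using assms(2) by (rule power_mono) simp
    finally have "?k ^ (4 * M) + M + 2 \<le> 4 * ?k ^ (4 * M)" by linarith
    moreover have "card (level M) \<le> ?k ^ (4 * M) + M + 2"
      unfolding level_def using fil[of M] clu[of M] refs[of M]
      by (intro card_Un_le[THEN le_trans] add_mono) simp_all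
    moreover have "finite (level M)" unfolding level_def using fil[of M] clu[of M] refs[of M] by blast
    ultimately show ?thesis by (simp add: power_mult)
  qed
  have M_le: "M \<le> m" if "base M \<le> n" for M
  proof (rule ccontr)
    assume "\<not> M \<le> m"
    then have "base (Suc m) \<le> base M" by (simp add: power_mono)
    then show False using that assms(1) by linarith
  qed
  have "{x \<in> lang. length x \<le> n} \<subseteq> insert [] (\<Union>M\<in>{..m}. level M)"
  proof
    fix x assume "x \<in> {x \<in> lang. length x \<le> n}"
    then have x: "x \<in> lang" "length x \<le> n" by simp_all
    from x(1) show "x \<in> insert [] (\<Union>M\<in>{..m}. level M)"
    proof (cases rule: lang_cases)
      case (filler M w)
      then have "M \<le> m" using M_le x(2) length_filler[of w M] by simp
      moreover have "x \<in> level M" using filler unfolding level_def by auto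
      ultimately show ?thesis by blast
    next
      case (mark j i)
      then have "\<sigma> j \<le> m" using M_le x(2) length_cluster[OF mark(4)] by simp
      moreover have "x \<in> level (\<sigma> j)" using mark(4) unfolding level_def by auto
      ultimately show ?thesis by blast
    next
      case (ref j s)
      then have "Suc (\<sigma> j) \<le> m" using M_le x(2) length_ref[of j s] by simp
      moreover have "s = 0 \<or> s = 1" using ref(2) by auto
      then have "x \<in> level (Suc (\<sigma> j))" using ref(1) unfolding level_def by auto
      ultimately show ?thesis by blast
    qed simp
  qed
  then have "growth lang n \<le> card (insert [] (\<Union>M\<in>{..m}. level M))"
    unfolding growth_def using level by (intro card_mono) auto
  also have "\<dots> \<le> Suc (card (\<Union>M\<in>{..m}. level M))"
    using level by (simp add: card_insert_if)
  also have "card (\<Union>M\<in>{..m}. level M) \<le> (\<Sum>M\<in>{..m}. card (level M))"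
    by (rule card_UN_le) simp
  also have "\<dots> \<le> (\<Sum>M\<in>{..m}. 4 * (?k ^ 4) ^ M)" using level by (intro sum_mono) blast
  also have "\<dots> \<le> 8 * (?k ^ 4) ^ m"
  proof -
    \<comment> \<open>For a ratio of at least 2 the sum is at most twice its last term.\<close>
    have "(\<Sum>M\<le>l. 4 * q ^ M) \<le> 8 * q ^ l" if "2 \<le> q" for q l :: nat
    proof (induction l)
      case (Suc l)
      have "2 * q ^ l \<le> q ^ Suc l" using that by simp
      with Suc show ?case unfolding sum.atMost_Suc by linarith
    qed simp
    moreover have "2 \<le> ?k ^ 4" using assms(2) self_le_power[of ?k 4] by linarith
    ultimately show ?thesis by blast
  qed
  also have "Suc (8 * (?k ^ 4) ^ m) \<le> 9 * ?k ^ (4 * m)"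
  proof -
    have "1 \<le> ?k ^ (4 * m)" using assms(2) by simp
    then show ?thesis by (simp add: power_mult)
  qed
  finally show ?thesis by simp
qed

text \<open>With \<open>m n\<close> the integer part of a quarter of \<open>sqrt n\<close>, the
  length \<open>n\<close> lies between \<open>base (m n)\<close> and the next level, and
  \<open>card A ^ (4 * m n)\<close> agrees with the claimed growth up to a constant factor.\<close>

lemma growth_lang_bigtheta:
  assumes "2 \<le> card A"
  shows "(\<lambda>n. real (growth lang n)) \<in> \<Theta>(\<lambda>n. real (card A) powr sqrt (real n))"
proof -
  let ?k = "real (card A)"
  have k: "1 < ?k" using assms by simp
  define m where "m n = nat \<lfloor>sqrt (real n) / 4\<rfloor>" for n
  have m: "4 * real (m n) \<le> sqrt (real n)" "sqrt (real n) < 4 * real (m n) + 4" for n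
  proof -
    have "0 \<le> sqrt (real n) / 4" by simp
    then have "real (m n) \<le> sqrt (real n) / 4" "sqrt (real n) / 4 < real (m n) + 1"
      unfolding m_def by linarith+
    then show "4 * real (m n) \<le> sqrt (real n)" "sqrt (real n) < 4 * real (m n) + 4" by simp_all
  qed
  have base_m: "base (m n) \<le> n" "n < base (Suc (m n))" for n
  proof -
    have "(4 * real (m n)) ^ 2 \<le> real n"
      using power_mono[OF m(1), of n 2] by simp
    then have "real (base (m n)) \<le> real n" by (simp add: power_mult_distrib)
    then show "base (m n) \<le> n" by linarith
    have "real n < (4 * real (m n) + 4) ^ 2"
      using power_strict_mono[OF m(2)[of n], of 2] by simp
    then have "real n < real (base (Suc (m n)))" by (simp add: power2_eq_square algebra_simps)
    then show "n < base (Suc (m n))" by linarith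
  qed
  have "real (growth lang n) \<le> 9 * ?k powr sqrt (real n)" for n
  proof -
    have "real (growth lang n) \<le> real (9 * card A ^ (4 * m n))"
      using growth_lang_le[OF base_m(2)[of n] assms] by (simp only: of_nat_le_iff)
    also have "\<dots> = 9 * ?k powr (4 * real (m n))" using k by (simp add: powr_realpow[symmetric])
    also have "\<dots> \<le> 9 * ?k powr sqrt (real n)" using m(1)[of n] k by simp
    finally show ?thesis .
  qed
  then have "(\<lambda>n. real (growth lang n)) \<in> O(\<lambda>n. ?k powr sqrt (real n))"
    by (intro bigoI[of _ 9]) simp
  moreover have "?k powr sqrt (real n) \<le> ?k powr 8 * real (growth lang n)" if n: "base (Suc m0) \<le> n" for n
  proof -
    have "Suc m0 \<le> m n"
    proof (rule ccontr)
      assume "\<not> Suc m0 \<le> m n"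
      then have "base (Suc (m n)) \<le> base (Suc m0)" by (simp add: power_mono)
      then show False using n base_m(2)[of n] by linarith
    qed
    \<comment> \<open>Fillers of level \<open>m n\<close> may be longer than \<open>n\<close>, so
      the preceding level \<open>l\<close> is counted. As \<open>sqrt n < 4 * l + 8\<close>, this
      costs the factor \<open>?k powr 8\<close>.\<close>
    then obtain l where l: "m n = Suc l" "m0 \<le> l" by (cases "m n") auto
    have "base l + 5 * l + 4 \<le> n" using base_m(1)[of n] base_Suc[of l] unfolding l(1) by linarith
    then have "card A ^ (4 * l) \<le> growth lang n" using growth_lang_ge l(2) by simp
    then have *: "real (card A ^ (4 * l)) \<le> real (growth lang n)" by (simp only: of_nat_le_iff)
    have "?k powr sqrt (real n) \<le> ?k powr (8 + 4 * real l)"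
      using m(2)[of n] k l by simp
    also have "\<dots> = ?k powr 8 * real (card A ^ (4 * l))"
      using powr_realpow[of ?k "4 * l"] k by (simp add: powr_add)
    also have "\<dots> \<le> ?k powr 8 * real (growth lang n)" using * by (intro mult_left_mono) simp_all
    finally show ?thesis .
  qed
  then have "(\<lambda>n. ?k powr sqrt (real n)) \<in> O(\<lambda>n. real (growth lang n))"
    by (intro bigoI[of _ "?k powr 8"] eventually_sequentiallyI[of "base (Suc m0)"]) simp
  ultimately show ?thesis by (simp add: bigtheta_def bigomega_iff_bigo)
qed

end

section \<open>Choice of the parameters\<close>

theorem theorem4:
  fixes \<gamma> \<theta> :: real and k :: nat and A :: "'a set"
  assumes "\<gamma> > 0" and "\<theta> > 0"
    and "k \<ge> 2" and "finite A" and "card A = k"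
  shows "\<exists>L \<subseteq> lists A.
    (\<lambda>n. real (growth L n)) \<in> \<Theta>(\<lambda>n. real k powr sqrt (real n)) \<and>
    isom_group (lev A \<gamma> \<theta>) L \<cong>
      product_group (UNIV :: nat set) (\<lambda>_. sym_group k) \<times>\<times>
      product_group {n :: nat. n \<ge> 1} (\<lambda>n. sym_group (k ^ n))"
proof -
  have "\<not> card A \<le> Suc 0" using assms(3,5) by simp
  then obtain a b where ab: "a \<in> A" "b \<in> A" "a \<noteq> b"
    using card_le_Suc0_iff_eq[OF assms(4)] by blast
  obtain l where l: "(2 * \<gamma> + 2 * \<theta>) / \<gamma> < real l" using reals_Archimedean2 by blast
  define m0 where "m0 = Suc l"
  have m0: "2 * \<gamma> + 2 * \<theta> < \<gamma> * real m0"
    using l assms(1) by (simp add: m0_def divide_simps algebra_simps)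
  \<comment> \<open>Even indices provide the countably many copies of the symmetric group on
    \<open>k\<close> elements; the odd index \<open>2 * n - 1\<close> provides the one on
    \<open>k ^ n\<close> elements.\<close>
  define N where "N j = (if even j then k else k ^ (Suc j div 2))" for j
  have N: "2 \<le> N j" for j
  proof -
    have "k \<le> N j"
    proof (cases "even j")
      case False
      then have "k \<le> k ^ (Suc j div 2)" using assms(3) by (intro self_le_power) (auto elim!: oddE)
      then show ?thesis using False by (simp only: N_def if_False)
    qed (simp add: N_def)
    then show ?thesis using assms(3) by linarith
  qed
  define S where "S = {core a b m w | m w. m0 \<le> m \<and> w \<in> lists A \<and> length w = 4 * m}"
  have S_lists: "S \<subseteq> lists A" using ab by (auto simp: S_def core_def in_lists_conv_set)
  \<comment> \<open>The enumeration only has to be onto \<open>S\<close>, for which countability and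
    nonemptiness suffice.\<close>
  then have "countable S" by (rule countable_subset) (intro countable_lists countable_finite assms(4))
  have "replicate (4 * m0) a \<in> lists A" using ab by (auto simp: in_lists_conv_set)
  then have "core a b m0 (replicate (4 * m0) a) \<in> S" unfolding S_def by fastforce
  then have "S \<noteq> {}" by blast
  define e where "e = from_nat_into S"
  have e: "range e = S" unfolding e_def using \<open>S \<noteq> {}\<close> \<open>countable S\<close> by (rule range_from_nat_into)
  have "\<forall>j. \<exists>r\<in>lists A. \<not> subseq (e j) r \<and> (\<forall>y\<in>lists A. length y = length (e j) \<longrightarrow> y \<noteq> e j \<longrightarrow> subseq y r)"
  proof
    fix j
    have "e j \<in> S" using e by blast
    then have "e j \<noteq> []" "e j \<in> lists A" using S_lists by (auto simp: S_def core_def)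
    then show "\<exists>r\<in>lists A. \<not> subseq (e j) r \<and> (\<forall>y\<in>lists A. length y = length (e j) \<longrightarrow> y \<noteq> e j \<longrightarrow> subseq y r)"
      using avoiding_supersequence assms(3-5) by blast
  qed
  then obtain v where v: "\<And>j. v j \<in> lists A" "\<And>j. \<not> subseq (e j) (v j)"
    "\<And>j y. y \<in> lists A \<Longrightarrow> length y = length (e j) \<Longrightarrow> y \<noteq> e j \<Longrightarrow> subseq y (v j)"
    by metis
  \<comment> \<open>The partial sums start above \<open>m0\<close> and each dominates its last
    summand, which yields the lower bounds; the increments yield the gap.\<close>
  define \<sigma> where "\<sigma> j = m0 + (\<Sum>i\<le>j. N i + length (v i) + 2)" for j
  have \<sigma>: "m0 \<le> \<sigma> j" "N j \<le> \<sigma> j" "length (v j) \<le> \<sigma> j" "\<sigma> j + 2 + N (Suc j) \<le> \<sigma> (Suc j)" for j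
    using member_le_sum[of j "{..j}" "\<lambda>i. N i + length (v i) + 2"] by (auto simp: \<sigma>_def)
  interpret marked_language A \<gamma> \<theta> a b m0 N e v \<sigma>
  proof
    show "1 \<le> m0" by (simp add: m0_def)
    show "range e = {core a b m w | m w. m0 \<le> m \<and> w \<in> lists A \<and> length w = 4 * m}"
      using e unfolding S_def .
  qed (fact assms ab m0 N v \<sigma>)+
  have "product_group (UNIV :: nat set) (\<lambda>j. sym_group (N j)) \<cong>
      product_group (UNIV :: nat set) (\<lambda>i. sym_group (N (2 * i))) \<times>\<times>
      product_group {n :: nat. n \<ge> 1} (\<lambda>n. sym_group (N (2 * n - 1)))"
    by (rule product_group_even_odd)
  also have "(\<lambda>i. sym_group (N (2 * i))) = (\<lambda>_. sym_group k)" by (simp add: N_def)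
  also have "product_group {n :: nat. n \<ge> 1} (\<lambda>n. sym_group (N (2 * n - 1))) =
      product_group {n :: nat. n \<ge> 1} (\<lambda>n. sym_group (k ^ n))"
    by (rule product_group_cong) (auto simp: N_def)
  finally have "isom_group (lev A \<gamma> \<theta>) lang \<cong>
      product_group (UNIV :: nat set) (\<lambda>_. sym_group k) \<times>\<times>
      product_group {n :: nat. n \<ge> 1} (\<lambda>n. sym_group (k ^ n))"
    by (rule iso_trans[OF isom_group_lang])
  moreover have "(\<lambda>n. real (growth lang n)) \<in> \<Theta>(\<lambda>n. real k powr sqrt (real n))"
    using growth_lang_bigtheta assms(3,5) by simp
  ultimately show ?thesis using lang_lists by (intro exI[of _ lang] conjI)
qed

end
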